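(* Let $I\subseteq[n]$, $\overline J\subseteq[\overline n]$ be a valid pair and $G=G(I,\overline J)$. The triangulation $\mathscr T_{len}$ of $\mathcal F_{\widehat G}$ obtained by reducing the monomial $M_G$ in the length reduction order is a geometric realization of the $(I,\overline J)$-Tamari complex $\mathscr C_{I,\overline J}$; that is, assigning to the vertex $\chi(R)$ of $\mathcal F_{\widehat G}$, where the route $R$ begins with the edge $(s,i)$ and ends with the edge $(\mathrm{prec}(\overline j),t)$, the arc $(i,\overline j)$, is a bijection from the vertices of $\mathcal F_{\widehat G}$ to the arcs of $A(I,\overline J)$ under which the vertex sets of the simplices of $\mathscr T_{len}$ correspond exactly to the faces of $\mathscr C_{I,\overline J}$.
   Context: Fix $n\ge1$, $[n]=\{1,\dots,n\}$, $[\overline n]=\{\overline1,\dots,\overline n\}$, ordered by $1\prec\overline1\prec2\prec\cdots\prec n\prec\overline n$. A pair $I\subseteq[n]$, $\overline J\subseteq[\overline n]$ is valid if $\min(I\sqcup\overline J)\in I$, $\max(I\sqcup\overline J)\in\overline J$. Define $\mathrm{prec}:\overline J\to[n]$: if in $\prec$ restricted to $I\sqcup\overline J$ the element $\overline j$ is immediately preceded by some $i\in I$, then $\mathrm{prec}(\overline j)=i$, otherwise $\mathrm{prec}(\overline j)=j$. $A(I,\overline J)$ is the graph on $I\sqcup\overline J$ with arcs $(i,\overline j)$, $i\in I$, $\overline j\in\overline J$, $i\prec\overline j$. Let $\mathrm{prec}(A(I,\overline J))$ be the simple directed graph on $I\cup\mathrm{prec}(\overline J)\subseteq[n]$ with edges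 $(i,\mathrm{prec}(\overline j))$ for $i\in I$, $\overline j\in\overline J$, $i<\mathrm{prec}(\overline j)$; $\min(H)$ deletes each edge $(i,j)$ of $H$ for which $H$ has a directed path from $i$ to $j$ with at least two edges; $G(I,\overline J)=\min(\mathrm{prec}(A(I,\overline J)))$. $\widehat G$ has vertex set $V(G)\cup\{s,t\}$ and edges $E(G)\cup\{(s,i):i\in I\}\cup\{(\mathrm{prec}(\overline j),t):\overline j\in\overline J\}$; routes are directed $s$–$t$ paths, $\chi(R)\in\mathbb R^{E(\widehat G)}$ the indicator vector; $\mathcal F_{\widehat G}=\mathrm{conv}\{\chi(R)\}$ is the unit $s$–$t$ flow polytope of $\widehat G$. Subdivision algebra: polynomials in commuting $\beta$, $x_{ab}$ ($a<b$); $M_G=\prod_{(a,b)\in E(G)}x_{ab}$; a reduction at $x_{ij},x_{jk}$ ($i<j<k$) replaces, in a monomial divisible by $x_{ij}x_{jk}$, this factor by $x_{ik}x_{ij}+x_{jk}x_{ik}+\beta x_{ik}$; a reduced form is obtained by reducing from $M_G$ until no monomial is divisible by any $x_{ij}x_{jk}$, $i<j<k$. The graph of a monomial has an edge $(a,b)$ per factor $x_{ab}$. A pair $(i,j),(j,k)$ with $i<j<k$ is a longest pair at $j$ if there is no edge $(i',j)$ with $i'<i$ and no edge $(j,k')$ with $k'>k$. The length reduction order: each reduction of a monomial is at a longest pair at $j$, where $j$ is the minimal vertex that is the middle vertex of some pair $(i,j),(j,k)$ with $i<j<k$ in the monomial's graph. For a factor $x_{ab}$ of a monomial of a reduced form,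 $R_{ab}$ is the route $(s,a)$, the unique directed path in $G$ from $a$ to $b$, $(b,t)$. If $p$ is the reduced form obtained in the length reduction order, $\mathscr T_{len}$ is the triangulation of $\mathcal F_{\widehat G}$ whose maximal simplices are $\Delta_M=\mathrm{conv}(\{\chi(R_{ab}):x_{ab}\mid M\}\cup\{\chi(s,v,t):v\in I\cap\mathrm{prec}(\overline J)\})$ for the monomials $M$ of $p$ not divisible by $\beta$. Two arcs $(i,\overline j),(i',\overline j')$ of $A(I,\overline J)$ cross if $i\prec i'\prec\overline j\prec\overline j'$. An $(I,\overline J)$-forest is a subgraph of $A(I,\overline J)$ with no two crossing arcs. The $(I,\overline J)$-Tamari complex $\mathscr C_{I,\overline J}$ is the flag simplicial complex whose vertices are the arcs of $A(I,\overline J)$ and whose faces are the arc sets of $(I,\overline J)$-forests (minimal non-faces: pairs of crossing arcs). *)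

theory Defs
  imports "HOL-Analysis.Analysis" "HOL-Library.Poly_Mapping"
begin

text \<open>\<open>Plain i\<close> stands for $i$ and \<open>Bar j\<close> for $\overline j$. Throughout, a set
  $\overline J$ of barred indices is given as \<open>Bar ` J\<close> for a set \<open>J\<close> of natural numbers.\<close>

datatype node = Plain nat | Bar nat

fun node_pos :: "node \<Rightarrow> nat" where
  "node_pos (Plain i) = 2 * i"
| "node_pos (Bar j) = 2 * j + 1"

lemma node_pos_inject: "node_pos a = node_pos b \<longleftrightarrow> a = b"
  by (cases a; cases b) (auto, presburger+)

text \<open>The order $1 \prec \overline 1 \prec 2 \prec \overline 2 \prec \cdots$ is \<open><\<close> on nodes.\<close>

instantiation node :: linorder
begin

definition less_eq_node :: "node \<Rightarrow> node \<Rightarrow> bool" where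
  "less_eq_node a b \<longleftrightarrow> node_pos a \<le> node_pos b"

definition less_node :: "node \<Rightarrow> node \<Rightarrow> bool" where
  "less_node a b \<longleftrightarrow> node_pos a < node_pos b"

instance
  by standard (auto simp: less_eq_node_def less_node_def node_pos_inject)

end

definition nodes :: "nat set \<Rightarrow> nat set \<Rightarrow> node set" where
  "nodes I J = Plain ` I \<union> Bar ` J"

definition valid_pair :: "nat \<Rightarrow> nat set \<Rightarrow> nat set \<Rightarrow> bool" where
  "valid_pair n I J \<longleftrightarrow> I \<subseteq> {1..n} \<and> J \<subseteq> {1..n} \<and>
     Min (nodes I J) \<in> Plain ` I \<and> Max (nodes I J) \<in> Bar ` J"

definition imm_precedes :: "nat set \<Rightarrow> nat set \<Rightarrow> node \<Rightarrow> node \<Rightarrow> bool" where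
  "imm_precedes I J a b \<longleftrightarrow> a \<in> nodes I J \<and> b \<in> nodes I J \<and> a < b \<and>
     \<not> (\<exists>c \<in> nodes I J. a < c \<and> c < b)"

definition prec :: "nat set \<Rightarrow> nat set \<Rightarrow> nat \<Rightarrow> nat" where
  "prec I J j =
     (if \<exists>i\<in>I. imm_precedes I J (Plain i) (Bar j)
      then THE i. i \<in> I \<and> imm_precedes I J (Plain i) (Bar j) else j)"

definition arcs :: "nat set \<Rightarrow> nat set \<Rightarrow> (node \<times> node) set" where
  "arcs I J = {(Plain i, Bar j) | i j. i \<in> I \<and> j \<in> J \<and> Plain i < Bar j}"

definition crossing :: "node \<times> node \<Rightarrow> node \<times> node \<Rightarrow> bool" where
  "crossing e f \<longleftrightarrow> fst e < fst f \<and> fst f < snd e \<and> snd e < snd f"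

text \<open>A subgraph is identified with its set of arcs, and a simplicial complex with its set of
  faces (including the empty face).\<close>

definition is_forest :: "nat set \<Rightarrow> nat set \<Rightarrow> (node \<times> node) set \<Rightarrow> bool" where
  "is_forest I J F \<longleftrightarrow> F \<subseteq> arcs I J \<and> \<not> (\<exists>e\<in>F. \<exists>f\<in>F. crossing e f)"

definition tamari_complex :: "nat set \<Rightarrow> nat set \<Rightarrow> (node \<times> node) set set" where
  "tamari_complex I J = {F. is_forest I J F}"

text \<open>Directed graphs are given by their edge sets; paths by their vertex lists.\<close>

definition dipath :: "('v \<times> 'v) set \<Rightarrow> 'v \<Rightarrow> 'v list \<Rightarrow> 'v \<Rightarrow> bool" where
  "dipath E u P v \<longleftrightarrow> P \<noteq> [] \<and> hd P = u \<and> last P = v \<and> distinct P \<and>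
     successively (\<lambda>a b. (a, b) \<in> E) P"

definition path_edges :: "'v list \<Rightarrow> ('v \<times> 'v) list" where
  "path_edges P = zip P (tl P)"

definition prec_graph :: "nat set \<Rightarrow> nat set \<Rightarrow> (nat \<times> nat) set" where
  "prec_graph I J = {(i, prec I J j) | i j. i \<in> I \<and> j \<in> J \<and> i < prec I J j}"

definition min_graph :: "('v \<times> 'v) set \<Rightarrow> ('v \<times> 'v) set" where
  "min_graph H = {(i, j) \<in> H. \<not> (\<exists>P. dipath H i P j \<and> length (path_edges P) \<ge> 2)}"

definition G_graph :: "nat set \<Rightarrow> nat set \<Rightarrow> (nat \<times> nat) set" where
  "G_graph I J = min_graph (prec_graph I J)"

datatype vertex = Source | Sink | V nat

definition hat_edges :: "nat set \<Rightarrow> nat set \<Rightarrow> (vertex \<times> vertex) set" where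
  "hat_edges I J =
     {(V a, V b) | a b. (a, b) \<in> G_graph I J} \<union>
     {(Source, V i) | i. i \<in> I} \<union>
     {(V (prec I J j), Sink) | j. j \<in> J}"

definition routes :: "nat set \<Rightarrow> nat set \<Rightarrow> vertex list set" where
  "routes I J = {R. dipath (hat_edges I J) Source R Sink}"

text \<open>The space of real vectors indexed by a finite edge set is \<open>real^'e\<close>, where the map
  \<open>\<epsilon>\<close> from \<open>'e\<close> to edges is meant to be a bijection onto that edge set.\<close>

definition route_vec :: "('e::finite \<Rightarrow> vertex \<times> vertex) \<Rightarrow> vertex list \<Rightarrow> real^'e" where
  "route_vec \<epsilon> R = (\<chi> e. if \<epsilon> e \<in> set (path_edges R) then 1 else 0)"

definition flow_polytope ::
  "('e::finite \<Rightarrow> vertex \<times> vertex) \<Rightarrow> nat set \<Rightarrow> nat set \<Rightarrow> (real^'e) set" where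
  "flow_polytope \<epsilon> I J = convex hull (route_vec \<epsilon> ` routes I J)"

text \<open>Polynomials in \<open>Beta\<close> and \<open>X a b\<close> (only used with \<open>a < b\<close>): a monomial is its exponent
  vector, and a polynomial maps monomials to coefficients.\<close>

datatype var = Beta | X nat nat

type_synonym monomial = "var \<Rightarrow>\<^sub>0 nat"
type_synonym subdiv_poly = "monomial \<Rightarrow>\<^sub>0 int"

definition pvar :: "var \<Rightarrow> subdiv_poly" where
  "pvar v = Poly_Mapping.single (Poly_Mapping.single v 1) 1"

definition graph_monomial :: "(nat \<times> nat) set \<Rightarrow> subdiv_poly" where
  "graph_monomial E = (\<Prod>(a, b)\<in>E. pvar (X a b))"

definition var_dvd :: "var \<Rightarrow> monomial \<Rightarrow> bool" where
  "var_dvd v M \<longleftrightarrow> Poly_Mapping.lookup M v \<ge> 1"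

definition is_pair :: "monomial \<Rightarrow> nat \<Rightarrow> nat \<Rightarrow> nat \<Rightarrow> bool" where
  "is_pair M i j k \<longleftrightarrow> i < j \<and> j < k \<and> var_dvd (X i j) M \<and> var_dvd (X j k) M"

definition longest_pair :: "monomial \<Rightarrow> nat \<Rightarrow> nat \<Rightarrow> nat \<Rightarrow> bool" where
  "longest_pair M i j k \<longleftrightarrow> is_pair M i j k \<and>
     \<not> (\<exists>i'<i. var_dvd (X i' j) M) \<and> \<not> (\<exists>k'>k. var_dvd (X j k') M)"

definition reduction_at ::
  "monomial \<Rightarrow> nat \<Rightarrow> nat \<Rightarrow> nat \<Rightarrow> subdiv_poly \<Rightarrow> subdiv_poly \<Rightarrow> bool" where
  "reduction_at M i j k p q \<longleftrightarrow>
     M \<in> Poly_Mapping.keys p \<and> i < j \<and> j < k \<and>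
     (\<exists>N. M = N + Poly_Mapping.single (X i j) 1 + Poly_Mapping.single (X j k) 1 \<and>
          q = p - Poly_Mapping.single M (Poly_Mapping.lookup p M)
                + Poly_Mapping.single N (Poly_Mapping.lookup p M) *
                  (pvar (X i k) * pvar (X i j) + pvar (X j k) * pvar (X i k)
                   + pvar Beta * pvar (X i k)))"

definition length_step :: "subdiv_poly \<Rightarrow> subdiv_poly \<Rightarrow> bool" where
  "length_step p q \<longleftrightarrow>
     (\<exists>M i j k. reduction_at M i j k p q \<and> longest_pair M i j k \<and>
        (\<forall>j'<j. \<not> (\<exists>i' k'. is_pair M i' j' k')))"

definition is_reduced :: "subdiv_poly \<Rightarrow> bool" where
  "is_reduced p \<longleftrightarrow> (\<forall>M \<in> Poly_Mapping.keys p. \<not> (\<exists>i j k. is_pair M i j k))"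

definition length_reduced_form :: "(nat \<times> nat) set \<Rightarrow> subdiv_poly \<Rightarrow> bool" where
  "length_reduced_form E p \<longleftrightarrow> length_step\<^sup>*\<^sup>* (graph_monomial E) p \<and> is_reduced p"

definition factor_route :: "nat set \<Rightarrow> nat set \<Rightarrow> nat \<Rightarrow> nat \<Rightarrow> vertex list" where
  "factor_route I J a b = Source # map V (THE P. dipath (G_graph I J) a P b) @ [Sink]"

definition Delta ::
  "('e::finite \<Rightarrow> vertex \<times> vertex) \<Rightarrow> nat set \<Rightarrow> nat set \<Rightarrow> monomial \<Rightarrow> (real^'e) set" where
  "Delta \<epsilon> I J M = convex hull
     ({route_vec \<epsilon> (factor_route I J a b) | a b. var_dvd (X a b) M} \<union>
      {route_vec \<epsilon> [Source, V v, Sink] | v. v \<in> I \<inter> prec I J ` J})"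

text \<open>All simplices (including the empty one) of the complex generated by the \<open>Delta \<epsilon> I J M\<close>.\<close>

definition T_len ::
  "('e::finite \<Rightarrow> vertex \<times> vertex) \<Rightarrow> nat set \<Rightarrow> nat set \<Rightarrow> subdiv_poly \<Rightarrow> (real^'e) set set" where
  "T_len \<epsilon> I J p =
     {S. \<exists>M \<in> Poly_Mapping.keys p. \<not> var_dvd Beta M \<and> S face_of Delta \<epsilon> I J M}"

definition vertices_of :: "'a::real_vector set \<Rightarrow> 'a set" where
  "vertices_of P = {v. v extreme_point_of P}"

end

theory Submission
  imports Defs
begin

text \<open>Write \<open>K\<close> for the image of \<open>prec\<close>. Then \<open>prec\<close> is strictly increasing, so arcs are the pairs
  \<open>(a, b)\<close> with \<open>a \<in> I\<close>, \<open>b \<in> K\<close>, \<open>a \<le> b\<close>, two of which cross iff \<open>a < a' \<le> b < b'\<close>; and \<open>G\<close> is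
  a caterpillar with spine \<open>I \<inter> K\<close>, so routes are determined by their end points and uncrossing two
  arcs does not change the sum of the two route vectors. Non-negative weights on arcs with
  non-crossing support are determined by their marginals (compare two of them on a shortest arc
  where they differ), and every convex combination of route vectors can be uncrossed. Hence the
  non-crossing sets of arcs triangulate the polytope.

  On the algebraic side, a reduction at a longest pair never creates two crossing edges, so the
  monomials of a reduced form yield non-crossing sets. Conversely, a flow on the graph of a monomial
  can be rerouted to one of the two \<open>\<beta>\<close>-free monomials that replace it; following the flow given by
  a non-crossing set \<open>F\<close> down to the reduced form and using uniqueness of non-crossing weights
  shows that \<open>F\<close> is contained in the set of some monomial.\<close>

subsection \<open>Non-crossing weights\<close>

text \<open>A pair \<open>(a, b)\<close> stands for the arc from the plain node \<open>a\<close> to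
  the barred node whose image under \<open>prec\<close> is \<open>b\<close>. The case
  \<open>b = a'\<close> counts as a crossing, because the plain node \<open>b\<close> precedes that
  barred node.\<close>

definition noncrossing :: "(nat \<times> nat) set \<Rightarrow> bool" where
  "noncrossing F \<longleftrightarrow>
     (\<forall>a b a' b'. (a, b) \<in> F \<longrightarrow> (a', b') \<in> F \<longrightarrow> a < a' \<longrightarrow> b < b' \<longrightarrow> b < a')"

lemma noncrossing_subset: "noncrossing F \<Longrightarrow> F' \<subseteq> F \<Longrightarrow> noncrossing F'"
  unfolding noncrossing_def by blast

lemma sum_eq_imp_less_partner:
  fixes w w' :: "'a \<Rightarrow> real"
  assumes "finite S" "sum w S = sum w' S" "e \<in> S" "w' e < w e"
  shows "\<exists>e'\<in>S. w e' < w' e'"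
proof (rule ccontr)
  assume "\<not> ?thesis"
  then have "\<forall>x\<in>S. w' x \<le> w x" by force
  then have "sum w' S < sum w S"
    using assms(1,3,4) by (intro sum_strict_mono_ex1) auto
  with assms(2) show False by simp
qed

text \<open>If \<open>w\<close> exceeded \<open>w'\<close> at \<open>(i, j)\<close>, equal marginals
  would give \<open>(i, j1)\<close> and \<open>(i1, j)\<close> at which \<open>w'\<close> exceeds
  \<open>w\<close>. Neither is shorter than \<open>(i, j)\<close>, so \<open>i1 < i\<close> and
  \<open>j < j1\<close>, and two members of the support of \<open>w'\<close> cross.\<close>

lemma noncrossing_weights_le_on_shortest:
  fixes w w' :: "nat \<times> nat \<Rightarrow> real"
  assumes fin: "finite P" and ord: "\<And>a b. (a, b) \<in> P \<Longrightarrow> a \<le> b"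
    and nonneg: "\<And>e. e \<in> P \<Longrightarrow> 0 \<le> w e"
    and nc: "noncrossing {e \<in> P. w' e \<noteq> 0}"
    and out: "\<And>a. (\<Sum>e | e \<in> P \<and> fst e = a. w e) = (\<Sum>e | e \<in> P \<and> fst e = a. w' e)"
    and inn: "\<And>b. (\<Sum>e | e \<in> P \<and> snd e = b. w e) = (\<Sum>e | e \<in> P \<and> snd e = b. w' e)"
    and e: "(i, j) \<in> P"
    and shortest: "\<And>a b. (a, b) \<in> P \<Longrightarrow> b - a < j - i \<Longrightarrow> w (a, b) = w' (a, b)"
  shows "w (i, j) \<le> w' (i, j)"
proof (rule ccontr)
  assume "\<not> ?thesis"
  then have gt: "w' (i, j) < w (i, j)" by simp
  obtain j1 where j1: "(i, j1) \<in> P" "w (i, j1) < w' (i, j1)"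
    using sum_eq_imp_less_partner[OF _ out[of i], of "(i, j)"] fin e gt by auto
  obtain i1 where i1: "(i1, j) \<in> P" "w (i1, j) < w' (i1, j)"
    using sum_eq_imp_less_partner[OF _ inn[of j], of "(i, j)"] fin e gt by auto
  have ij: "i \<le> j" "i \<le> j1" "i1 \<le> j" using ord e i1 j1 by auto
  have "j1 \<noteq> j" "i1 \<noteq> i" using i1 j1 gt by auto
  moreover have "\<not> j1 < j" using shortest[OF j1(1)] j1(2) ij by fastforce
  moreover have "\<not> i < i1" using shortest[OF i1(1)] i1(2) ij by fastforce
  ultimately have "i1 < i" "j < j1" by auto
  moreover have "w' (i1, j) \<noteq> 0" "w' (i, j1) \<noteq> 0"
    using nonneg[OF i1(1)] nonneg[OF j1(1)] i1 j1 by auto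
  ultimately have "j < i"
    using nc i1(1) j1(1) unfolding noncrossing_def by blast
  with ij show False by simp
qed

text \<open>Induction on the length of the arc; the preceding lemma applies with the two weights in
  either order and gives both inequalities.\<close>

lemma noncrossing_weights_unique:
  fixes w w' :: "nat \<times> nat \<Rightarrow> real"
  assumes fin: "finite P" and ord: "\<And>a b. (a, b) \<in> P \<Longrightarrow> a \<le> b"
    and nonneg: "\<And>e. e \<in> P \<Longrightarrow> 0 \<le> w e" "\<And>e. e \<in> P \<Longrightarrow> 0 \<le> w' e"
    and nc: "noncrossing {e \<in> P. w e \<noteq> 0}" "noncrossing {e \<in> P. w' e \<noteq> 0}"
    and out: "\<And>a. (\<Sum>e | e \<in> P \<and> fst e = a. w e) = (\<Sum>e | e \<in> P \<and> fst e = a. w' e)"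
    and inn: "\<And>b. (\<Sum>e | e \<in> P \<and> snd e = b. w e) = (\<Sum>e | e \<in> P \<and> snd e = b. w' e)"
    and "e \<in> P"
  shows "w e = w' e"
proof -
  have "w (i, j) = w' (i, j)" if "(i, j) \<in> P" for i j
    using that
  proof (induction "j - i" arbitrary: i j rule: less_induct)
    case less
    show ?case
    proof (rule order.antisym)
      show "w (i, j) \<le> w' (i, j)"
        by (rule noncrossing_weights_le_on_shortest[OF fin ord nonneg(1) nc(2) out inn less(2)])
          (use less(1) in auto)
      show "w' (i, j) \<le> w (i, j)"
        by (rule noncrossing_weights_le_on_shortest
            [OF fin ord nonneg(2) nc(1) out[symmetric] inn[symmetric] less(2)])
          (use less(1)[symmetric] in auto)
    qed
  qed
  then show ?thesis using \<open>e \<in> P\<close> by (cases e) auto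
qed

text \<open>The functionals read off from a weighted sum of the vectors the total weight that leaves
  \<open>a\<close> or enters \<open>b\<close>; \<open>uncross\<close> exchanges two crossing arcs
  for two others with the same sum.\<close>

locale noncrossing_configuration =
  fixes P :: "(nat \<times> nat) set" and vec :: "nat \<times> nat \<Rightarrow> 'a::euclidean_space"
  assumes finite_P: "finite P"
    and ordered: "\<And>a b. (a, b) \<in> P \<Longrightarrow> a \<le> b"
    and uncross: "\<And>a b a' b'. \<lbrakk>(a, b) \<in> P; (a', b') \<in> P; a < a'; a' \<le> b; b < b'\<rbrakk> \<Longrightarrow>
      (a', b) \<in> P \<and> (a, b') \<in> P \<and> vec (a, b) + vec (a', b') = vec (a', b) + vec (a, b')"
    and out_functional: "\<And>a. \<exists>l. linear l \<and> (\<forall>e\<in>P. l (vec e) = (if fst e = a then 1 else 0 :: real))"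
    and in_functional: "\<And>b. \<exists>l. linear l \<and> (\<forall>e\<in>P. l (vec e) = (if snd e = b then 1 else 0 :: real))"
begin

lemma marginal_eq:
  assumes eq: "(\<Sum>e\<in>P. u e *\<^sub>R vec e) = (\<Sum>e\<in>P. u' e *\<^sub>R vec e)"
    and l: "linear l" "\<forall>e\<in>P. l (vec e) = (if g e = a then 1 else 0 :: real)"
  shows "(\<Sum>e | e \<in> P \<and> g e = a. u e) = (\<Sum>e | e \<in> P \<and> g e = a. u' e)"
proof -
  have *: "l (\<Sum>e\<in>P. v e *\<^sub>R vec e) = (\<Sum>e | e \<in> P \<and> g e = a. v e)" for v
  proof -
    have "l (\<Sum>e\<in>P. v e *\<^sub>R vec e) = (\<Sum>e\<in>P. v e * l (vec e))"
      by (simp add: linear_sum[OF l(1)] linear_scale[OF l(1)])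
    also have "\<dots> = (\<Sum>e\<in>P. if g e = a then v e else 0)"
      using l(2) by (intro sum.cong) auto
    also have "\<dots> = (\<Sum>e | e \<in> P \<and> g e = a. v e)"
      using finite_P by (simp add: sum.inter_filter)
    finally show ?thesis .
  qed
  show ?thesis using *[of u] *[of u'] eq by simp
qed

text \<open>Applying the functionals to both sides equates the marginals of \<open>u\<close> and
  \<open>u'\<close>.\<close>

lemma combination_unique:
  assumes "\<And>e. e \<in> P \<Longrightarrow> 0 \<le> u e" "\<And>e. e \<in> P \<Longrightarrow> 0 \<le> u' e"
    and "noncrossing {e \<in> P. u e \<noteq> 0}" "noncrossing {e \<in> P. u' e \<noteq> 0}"
    and eq: "(\<Sum>e\<in>P. u e *\<^sub>R vec e) = (\<Sum>e\<in>P. u' e *\<^sub>R vec e)" and "e \<in> P"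
  shows "u e = u' e"
proof (rule noncrossing_weights_unique[OF finite_P ordered assms(1-4)])
  show "(\<Sum>e | e \<in> P \<and> fst e = a. u e) = (\<Sum>e | e \<in> P \<and> fst e = a. u' e)" for a
  proof -
    obtain l where "linear l" "\<forall>e\<in>P. l (vec e) = (if fst e = a then 1 else 0 :: real)"
      using out_functional[of a] by blast
    from marginal_eq[OF eq this] show ?thesis .
  qed
  show "(\<Sum>e | e \<in> P \<and> snd e = a. u e) = (\<Sum>e | e \<in> P \<and> snd e = a. u' e)" for a
  proof -
    obtain l where "linear l" "\<forall>e\<in>P. l (vec e) = (if snd e = a then 1 else 0 :: real)"
      using in_functional[of a] by blast
    from marginal_eq[OF eq this] show ?thesis .
  qed
qed (use \<open>e \<in> P\<close> in auto)

lemma inj_on_vec: "inj_on vec P"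
proof (rule inj_onI)
  fix e e' assume e: "e \<in> P" "e' \<in> P" "vec e = vec e'"
  obtain l where "\<forall>x\<in>P. l (vec x) = (if fst x = fst e then 1 else 0 :: real)"
    using out_functional[of "fst e"] by blast
  from this[THEN bspec, OF e(1)] this[THEN bspec, OF e(2)] have "fst e' = fst e"
    using e(3) by (simp split: if_splits)
  moreover obtain l where "\<forall>x\<in>P. l (vec x) = (if snd x = snd e then 1 else 0 :: real)"
    using in_functional[of "snd e"] by blast
  from this[THEN bspec, OF e(1)] this[THEN bspec, OF e(2)] have "snd e' = snd e"
    using e(3) by (simp split: if_splits)
  ultimately show "e = e'" by (simp add: prod_eq_iff)
qed

text \<open>The weights live on \<open>P\<close> and vanish off \<open>F\<close>, so that points of
  different hulls are compared over one index set. The map \<open>f\<close> is arbitrary because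
  both \<open>vec\<close> and the lifted vectors in \<open>hull_noncrossing\<close> are
  needed.\<close>

lemma hull_iff:
  fixes f :: "nat \<times> nat \<Rightarrow> 'c::real_vector"
  assumes inj: "inj_on f P" and F: "F \<subseteq> P"
  shows "x \<in> convex hull (f ` F) \<longleftrightarrow>
    (\<exists>u. (\<forall>e\<in>P. 0 \<le> u e) \<and> (\<forall>e\<in>P - F. u e = 0) \<and> sum u P = 1 \<and> x = (\<Sum>e\<in>P. u e *\<^sub>R f e))"
    (is "?L \<longleftrightarrow> ?R")
proof -
  have finF: "finite F" and injF: "inj_on f F"
    using F finite_P finite_subset inj inj_on_subset by blast+
  show ?thesis
  proof
    assume ?L
    then obtain u where u: "\<forall>y\<in>f ` F. 0 \<le> u y" "sum u (f ` F) = 1"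
      "(\<Sum>y\<in>f ` F. u y *\<^sub>R y) = x"
      using finF by (auto simp: convex_hull_finite)
    define v where "v e = (if e \<in> F then u (f e) else 0)" for e
    have "sum v P = sum v F"
      by (rule sum.mono_neutral_right) (use F finite_P in \<open>auto simp: v_def\<close>)
    also have "\<dots> = 1" using u(2) injF by (simp add: v_def sum.reindex)
    finally have "sum v P = 1" .
    moreover have "(\<Sum>e\<in>P. v e *\<^sub>R f e) = (\<Sum>e\<in>F. v e *\<^sub>R f e)"
      by (rule sum.mono_neutral_right) (use F finite_P in \<open>auto simp: v_def\<close>)
    then have "x = (\<Sum>e\<in>P. v e *\<^sub>R f e)" using u(3) injF by (simp add: v_def sum.reindex)
    ultimately show ?R using u(1) by (intro exI[of _ v]) (auto simp: v_def)
  next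
    assume ?R
    then obtain u where u: "\<forall>e\<in>P. 0 \<le> u e" "\<forall>e\<in>P - F. u e = 0" "sum u P = 1"
      "x = (\<Sum>e\<in>P. u e *\<^sub>R f e)" by blast
    have "sum u P = sum u F" "(\<Sum>e\<in>P. u e *\<^sub>R f e) = (\<Sum>e\<in>F. u e *\<^sub>R f e)"
      by (rule sum.mono_neutral_right; use F finite_P u(2) in auto)+
    moreover have "(\<Sum>e\<in>F. u e *\<^sub>R f e) \<in> convex hull (f ` F)"
      using u(1,3) F calculation by (intro convex_sum finF convex_convex_hull) (auto intro: hull_inc)
    ultimately show ?L using u(4) by simp
  qed
qed

text \<open>The positive and the negative part of a dependency represent the same vector with
  non-crossing supports, so they agree; a number whose positive and negative parts agree is
  zero.\<close>

lemma affine_independent_vec: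
  assumes F: "F \<subseteq> P" "noncrossing F"
  shows "\<not> affine_dependent (vec ` F)"
proof
  assume dep: "affine_dependent (vec ` F)"
  have finF: "finite F" and injF: "inj_on vec F"
    using F finite_P finite_subset inj_on_vec inj_on_subset by blast+
  from dep finF obtain U where U: "\<exists>v\<in>vec ` F. U v \<noteq> 0" "(\<Sum>v\<in>vec ` F. U v *\<^sub>R v) = 0"
    using affine_dependent_explicit_finite[of "vec ` F"] by blast
  define w where "w e = (if e \<in> F then U (vec e) else 0)" for e
  have "(\<Sum>e\<in>P. w e *\<^sub>R vec e) = (\<Sum>e\<in>F. w e *\<^sub>R vec e)"
    by (rule sum.mono_neutral_right) (use F finite_P in \<open>auto simp: w_def\<close>)
  also have "\<dots> = 0" using U(2) injF by (simp add: w_def sum.reindex)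
  finally have sum_w: "(\<Sum>e\<in>P. w e *\<^sub>R vec e) = 0" .
  have "(\<Sum>e\<in>P. (max (w e) 0 - max (- w e) 0) *\<^sub>R vec e) = (\<Sum>e\<in>P. w e *\<^sub>R vec e)"
    by (rule sum.cong) (simp_all add: max_def)
  with sum_w have eq: "(\<Sum>e\<in>P. max (w e) 0 *\<^sub>R vec e) = (\<Sum>e\<in>P. max (- w e) 0 *\<^sub>R vec e)"
    by (simp add: scaleR_left_diff_distrib sum_subtractf)
  have nc: "noncrossing {e \<in> P. max (w e) 0 \<noteq> 0}" "noncrossing {e \<in> P. max (- w e) 0 \<noteq> 0}"
    by (auto intro!: noncrossing_subset[OF F(2)] simp: w_def split: if_splits)
  have "w e = 0" if "e \<in> P" for e
  proof -
    have "max (w e) 0 = max (- w e) 0"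
      by (rule combination_unique[OF _ _ nc eq that]) simp_all
    then show ?thesis by (simp add: max_def split: if_splits)
  qed
  then have "U (vec e) = 0" if "e \<in> F" for e
    using that F(1)[THEN subsetD, OF that] unfolding w_def by presburger
  then show False using U(1) by blast
qed

text \<open>A common point has only one representation with non-crossing support, so its weights
  vanish off \<open>F\<close> as well as off \<open>F'\<close>.\<close>

lemma hull_Int:
  assumes F: "F \<subseteq> P" "noncrossing F" and F': "F' \<subseteq> P" "noncrossing F'"
  shows "convex hull (vec ` F) \<inter> convex hull (vec ` F') = convex hull (vec ` (F \<inter> F'))"
proof
  show "convex hull (vec ` F) \<inter> convex hull (vec ` F') \<subseteq> convex hull (vec ` (F \<inter> F'))"
  proof
    fix x assume "x \<in> convex hull (vec ` F) \<inter> convex hull (vec ` F')"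
    then have x: "x \<in> convex hull (vec ` F)" "x \<in> convex hull (vec ` F')" by blast+
    obtain u where u: "\<forall>e\<in>P. 0 \<le> u e" "\<forall>e\<in>P - F. u e = 0" "sum u P = 1"
      "x = (\<Sum>e\<in>P. u e *\<^sub>R vec e)"
      using x(1) unfolding hull_iff[OF inj_on_vec F(1)] by blast
    obtain u' where u': "\<forall>e\<in>P. 0 \<le> u' e" "\<forall>e\<in>P - F'. u' e = 0"
      "x = (\<Sum>e\<in>P. u' e *\<^sub>R vec e)"
      using x(2) unfolding hull_iff[OF inj_on_vec F'(1)] by blast
    have nc: "noncrossing {e \<in> P. u e \<noteq> 0}" "noncrossing {e \<in> P. u' e \<noteq> 0}"
      using u(2) u'(2) by (blast intro: noncrossing_subset[OF F(2)] noncrossing_subset[OF F'(2)])+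
    have eq: "(\<Sum>e\<in>P. u e *\<^sub>R vec e) = (\<Sum>e\<in>P. u' e *\<^sub>R vec e)"
      using u(4) u'(3) by metis
    have "u e = u' e" if "e \<in> P" for e
      using u(1) u'(1) by (intro combination_unique[OF _ _ nc eq that]) blast+
    then have "\<forall>e\<in>P - F \<inter> F'. u e = 0" using u(2) u'(2) by auto
    then show "x \<in> convex hull (vec ` (F \<inter> F'))"
      unfolding hull_iff[OF inj_on_vec le_infI1[OF F(1)]] using u by blast
  qed
qed (intro Int_greatest hull_mono image_mono; blast)

text \<open>Uncrossing two arcs strictly increases the weighted sum of \<open>- a * b\<close>, so a combination
  that maximises it has non-crossing support.\<close>

lemma hull_noncrossing:
  assumes x: "x \<in> convex hull (vec ` P)"
  shows "\<exists>F\<subseteq>P. noncrossing F \<and> x \<in> convex hull (vec ` F)"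
proof -
  define ht :: "nat \<times> nat \<Rightarrow> real" where "ht e = - real (fst e) * real (snd e)" for e
  \<comment> \<open>Taking the height as a further coordinate turns the maximisation over weights
    into one over the compact slice \<open>C\<close> above \<open>x\<close>, where the maximum is
    attained.\<close>
  define lift where "lift e = (vec e, ht e)" for e
  have inj: "inj_on lift P"
    using inj_on_vec by (auto simp: inj_on_def lift_def)
  define C where "C = convex hull (lift ` P) \<inter> ({x} \<times> UNIV)"
  have "compact C" unfolding C_def
    by (intro compact_Int_closed finite_imp_compact_convex_hull closed_Times) (use finite_P in auto)
  then have comp: "compact (snd ` C)"
    by (intro compact_continuous_image continuous_on_snd continuous_on_id)
  obtain u0 where u0: "\<forall>e\<in>P. 0 \<le> u0 e" "sum u0 P = 1" "x = (\<Sum>e\<in>P. u0 e *\<^sub>R vec e)"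
    using x unfolding hull_iff[OF inj_on_vec order_refl] by blast
  have lift_sum: "(\<Sum>e\<in>P. u e *\<^sub>R lift e) = (\<Sum>e\<in>P. u e *\<^sub>R vec e, \<Sum>e\<in>P. u e * ht e)" for u
    by (simp add: prod_eq_iff fst_sum snd_sum lift_def)
  have mem: "(\<Sum>e\<in>P. u e * ht e) \<in> snd ` C"
    if "\<forall>e\<in>P. 0 \<le> u e" "sum u P = 1" "x = (\<Sum>e\<in>P. u e *\<^sub>R vec e)" for u
  proof -
    have "(\<Sum>e\<in>P. u e *\<^sub>R lift e) \<in> convex hull (lift ` P)"
      unfolding hull_iff[OF inj order_refl] using that(1,2) by blast
    then have "(\<Sum>e\<in>P. u e *\<^sub>R lift e) \<in> C"
      using that(3) unfolding C_def lift_sum by blast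
    then show ?thesis unfolding lift_sum by (metis image_eqI snd_conv)
  qed
  have "snd ` C \<noteq> {}" using mem[OF u0] by blast
  from compact_attains_sup[OF comp this]
  obtain h where h: "h \<in> snd ` C" "\<And>y. y \<in> snd ` C \<Longrightarrow> y \<le> h" by blast
  from h(1) have "(x, h) \<in> convex hull (lift ` P)" by (auto simp: C_def)
  then obtain u where u: "\<forall>e\<in>P. 0 \<le> u e" "sum u P = 1" "(x, h) = (\<Sum>e\<in>P. u e *\<^sub>R lift e)"
    unfolding hull_iff[OF inj order_refl] by blast
  then have xh: "x = (\<Sum>e\<in>P. u e *\<^sub>R vec e)" "h = (\<Sum>e\<in>P. u e * ht e)"
    unfolding lift_sum by auto
  have "noncrossing {e \<in> P. u e \<noteq> 0}"
  proof (rule ccontr)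
    assume "\<not> ?thesis"
    then obtain a b a' b' where ab: "(a, b) \<in> P" "(a', b') \<in> P" "a < a'" "a' \<le> b" "b < b'"
      and nz: "u (a, b) \<noteq> 0" "u (a', b') \<noteq> 0"
      by (auto simp: noncrossing_def not_less)
    note un = uncross[OF ab]
    \<comment> \<open>The largest amount that can be moved from \<open>(a, b)\<close> and
      \<open>(a', b')\<close> to \<open>(a', b)\<close> and \<open>(a, b')\<close> without making a
      weight negative.\<close>
    define c where "c = min (u (a, b)) (u (a', b'))"
    have "0 \<le> u (a, b)" "0 \<le> u (a', b')" using u(1) ab by blast+
    then have c: "c > 0" using nz unfolding c_def by linarith
    define v where "v e = u e + ((if e = (a', b) then c else 0) + (if e = (a, b') then c else 0)
      - (if e = (a, b) then c else 0) - (if e = (a', b') then c else 0))" for e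
    have sumv: "(\<Sum>e\<in>P. v e *\<^sub>R g e) =
        (\<Sum>e\<in>P. u e *\<^sub>R g e) + c *\<^sub>R (g (a', b) + g (a, b') - g (a, b) - g (a', b'))"
      for g :: "nat \<times> nat \<Rightarrow> 'd::real_vector"
    proof -
      have d: "(\<Sum>e\<in>P. (if e = e0 then c else 0) *\<^sub>R g e) = c *\<^sub>R g e0" if "e0 \<in> P" for e0
        using finite_P that by (simp add: if_distrib[of "\<lambda>t. t *\<^sub>R _"] sum.delta cong: if_cong)
      show ?thesis using un ab
        by (simp only: v_def scaleR_left.add scaleR_left.diff sum.distrib sum_subtractf d
            scaleR_right_distrib scaleR_right_diff_distrib)
    qed
    have "0 \<le> v e" if "e \<in> P" for e
    proof -
      have "e = (a, b) \<Longrightarrow> c \<le> u e" "e = (a', b') \<Longrightarrow> c \<le> u e" "0 \<le> u e"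
        using u(1) that by (auto simp: c_def)
      then show ?thesis using ab(3) c by (auto simp: v_def)
    qed
    moreover have "sum v P = 1"
      using sumv[of "\<lambda>_. 1 :: real"] u(2) by simp
    moreover have "x = (\<Sum>e\<in>P. v e *\<^sub>R vec e)"
      using sumv[of vec] un xh(1) by (simp add: diff_diff_eq)
    ultimately have "(\<Sum>e\<in>P. v e * ht e) \<le> h" by (intro h(2) mem) auto
    moreover have "(\<Sum>e\<in>P. v e * ht e) = h + c * ((real a' - real a) * (real b' - real b))"
      using sumv[of ht] xh(2) by (simp add: ht_def algebra_simps)
    moreover have "c * ((real a' - real a) * (real b' - real b)) > 0"
      using c ab by simp
    ultimately show False by simp
  qed
  moreover have "x \<in> convex hull (vec ` {e \<in> P. u e \<noteq> 0})"
    unfolding hull_iff[OF inj_on_vec Collect_subset] using u(1,2) xh(1) by blast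
  ultimately show ?thesis using Collect_subset[of P "\<lambda>e. u e \<noteq> 0"] by blast
qed

section \<open>The simplicial complex of non-crossing sets of arcs\<close>

definition noncrossing_complex :: "'a set set" where
  "noncrossing_complex = {convex hull (vec ` F) | F. F \<subseteq> P \<and> noncrossing F}"

lemma face_of_hull_iff:
  assumes "F \<subseteq> P" "noncrossing F"
  shows "S face_of convex hull (vec ` F) \<longleftrightarrow> (\<exists>F'\<subseteq>F. S = convex hull (vec ` F'))"
  using face_of_convex_hull_affine_independent[OF affine_independent_vec[OF assms]]
  unfolding subset_image_iff by blast

text \<open>Affine independence makes each hull a simplex whose faces are the hulls of subsets, and
  by \<open>hull_Int\<close> two simplices meet in the hull of their common arcs.\<close>

lemma simplicial_complex_complex: "simplicial_complex noncrossing_complex"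
  unfolding simplicial_complex_def
proof (intro conjI ballI allI impI)
  show "finite noncrossing_complex"
    using finite_P by (simp add: noncrossing_complex_def)
next
  fix S assume "S \<in> noncrossing_complex"
  then obtain F where F: "F \<subseteq> P" "noncrossing F" "S = convex hull (vec ` F)"
    unfolding noncrossing_complex_def by blast
  then have "(int (card (vec ` F)) - 1) simplex S"
    using affine_independent_vec[OF F(1,2)] by (auto simp: simplex_def)
  then show "\<exists>n. n simplex S" ..
next
  fix T S assume "S \<in> noncrossing_complex \<and> T face_of S"
  then obtain F where F: "F \<subseteq> P" "noncrossing F" "T face_of convex hull (vec ` F)"
    unfolding noncrossing_complex_def by blast
  then obtain F' where "F' \<subseteq> F" "T = convex hull (vec ` F')"
    unfolding face_of_hull_iff[OF F(1,2)] by blast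
  then show "T \<in> noncrossing_complex"
    using F noncrossing_subset[OF F(2)] unfolding noncrossing_complex_def by blast
next
  fix S S' assume "S \<in> noncrossing_complex \<and> S' \<in> noncrossing_complex"
  then obtain F F' where F: "F \<subseteq> P" "noncrossing F" "S = convex hull (vec ` F)"
    and F': "F' \<subseteq> P" "noncrossing F'" "S' = convex hull (vec ` F')"
    unfolding noncrossing_complex_def by blast
  show "S \<inter> S' face_of S"
    unfolding F(3) F'(3) hull_Int[OF F(1,2) F'(1,2)] face_of_hull_iff[OF F(1,2)] by blast
qed

lemma Union_complex: "\<Union> noncrossing_complex = convex hull (vec ` P)"
proof (intro equalityI subsetI)
  fix x assume "x \<in> \<Union> noncrossing_complex"
  then obtain F where F: "F \<subseteq> P" "x \<in> convex hull (vec ` F)"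
    unfolding noncrossing_complex_def by blast
  then show "x \<in> convex hull (vec ` P)"
    using hull_mono[OF image_mono[OF F(1)], of convex vec] by blast
next
  fix x assume "x \<in> convex hull (vec ` P)"
  from hull_noncrossing[OF this] show "x \<in> \<Union> noncrossing_complex"
    unfolding noncrossing_complex_def by blast
qed

lemma extreme_points_hull:
  assumes "F \<subseteq> P" "noncrossing F"
  shows "vertices_of (convex hull (vec ` F)) = vec ` F"
  by (simp add: vertices_of_def affine_independent_vec[OF assms]
      extreme_point_of_convex_hull_affine_independent)

end

subsection \<open>Flows on planar graphs\<close>

text \<open>Unlike \<open>noncrossing\<close>, this permits \<open>b = a'\<close>, so that
  consecutive edges \<open>(i, j)\<close>, \<open>(j, k)\<close>, on which reductions act, can
  occur.\<close>

definition planar :: "(nat \<times> nat) set \<Rightarrow> bool" where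
  "planar E \<longleftrightarrow>
     (\<forall>a b a' b'. (a, b) \<in> E \<longrightarrow> (a', b') \<in> E \<longrightarrow> a < a' \<longrightarrow> b < b' \<longrightarrow> b \<le> a')"

lemma planarD: "\<lbrakk>planar E; (a, b) \<in> E; (a', b') \<in> E; a < a'; b < b'\<rbrakk> \<Longrightarrow> b \<le> a'"
  unfolding planar_def by blast

lemma planar_subset: "planar E \<Longrightarrow> E' \<subseteq> E \<Longrightarrow> planar E'"
  unfolding planar_def by blast

text \<open>An edge in conflict with \<open>(i, k)\<close> is already in conflict with
  \<open>(i, j)\<close> or \<open>(j, k)\<close>, unless it has \<open>j\<close> as an end. Then it
  enters \<open>j\<close> from before \<open>i\<close> or leaves \<open>j\<close> to beyond
  \<open>k\<close>, and the pair is not longest.\<close>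

lemma planar_insert_longest:
  assumes E: "planar E" "(i, j) \<in> E" "(j, k) \<in> E" "i < j" "j < k"
    and least: "\<And>i'. (i', j) \<in> E \<Longrightarrow> i \<le> i'" and greatest: "\<And>k'. (j, k') \<in> E \<Longrightarrow> k' \<le> k"
  shows "planar (insert (i, k) E)"
proof -
  have 1: "d \<le> i" if "(c, d) \<in> E" "c < i" "d < k" for c d
  proof (cases d j rule: linorder_cases)
    case less then show ?thesis using planarD[OF E(1) that(1) E(2)] that by simp
  next
    case equal then show ?thesis using least[of c] that by auto
  next
    case greater then show ?thesis using planarD[OF E(1) that(1) E(3)] that E(4) by simp
  qed
  have 2: "k \<le> c" if "(c, d) \<in> E" "i < c" "k < d" for c d
  proof (cases c j rule: linorder_cases)
    case less then show ?thesis using planarD[OF E(1,2) that(1)] that E(5) by simp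
  next
    case equal then show ?thesis using greatest[of d] that by auto
  next
    case greater then show ?thesis using planarD[OF E(1,3) that(1)] that by simp
  qed
  show ?thesis
    unfolding planar_def using 1 2 planarD[OF E(1)] by auto
qed

section \<open>Non-negative flows and their boundaries\<close>

definition bd :: "nat \<times> nat \<Rightarrow> nat \<Rightarrow> real" where
  "bd e v = of_bool (fst e = v) - of_bool (snd e = v)"

text \<open>\<open>d\<close> is the net outflow at each vertex of a non-negative flow on
  \<open>E\<close>. Loops have boundary zero and leave no trace in \<open>d\<close>.\<close>

definition carries :: "(nat \<times> nat) set \<Rightarrow> (nat \<Rightarrow> real) \<Rightarrow> bool" where
  "carries E d \<longleftrightarrow> (\<exists>f. (\<forall>e. 0 \<le> f e) \<and> (\<forall>v. d v = (\<Sum>e\<in>E. f e * bd e v)))"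

lemma carries_zero: "carries E (\<lambda>v. 0)"
  unfolding carries_def by (intro exI[of _ "\<lambda>_. 0"]) simp

lemma carries_edge: "finite E \<Longrightarrow> e \<in> E \<Longrightarrow> carries E (bd e)"
  unfolding carries_def
  by (intro exI[of _ "\<lambda>e'. of_bool (e' = e)"])
    (simp add: of_bool_def if_distrib[of "\<lambda>t. t * _"] cong: if_cong)

lemma carries_add:
  assumes "carries E d" "carries E d'" shows "carries E (\<lambda>v. d v + d' v)"
proof -
  obtain f f' where "\<forall>e. 0 \<le> f e" "\<forall>v. d v = (\<Sum>e\<in>E. f e * bd e v)"
    "\<forall>e. 0 \<le> f' e" "\<forall>v. d' v = (\<Sum>e\<in>E. f' e * bd e v)"
    using assms unfolding carries_def by blast
  then show ?thesis
    unfolding carries_def by (intro exI[of _ "\<lambda>e. f e + f' e"]) (simp add: distrib_right sum.distrib)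
qed

lemma carries_scale:
  assumes "carries E d" "0 \<le> c" shows "carries E (\<lambda>v. c * d v)"
proof -
  obtain f where "\<forall>e. 0 \<le> f e" "\<forall>v. d v = (\<Sum>e\<in>E. f e * bd e v)"
    using assms unfolding carries_def by blast
  with assms(2) show ?thesis
    unfolding carries_def by (intro exI[of _ "\<lambda>e. c * f e"]) (simp add: sum_distrib_left mult.assoc)
qed

lemma carries_sum:
  assumes "finite S" "\<And>x. x \<in> S \<Longrightarrow> carries E (d x)"
  shows "carries E (\<lambda>v. \<Sum>x\<in>S. d x v)"
  using assms by (induction S rule: finite_induct) (auto intro: carries_zero carries_add)

lemma carries_mono:
  assumes "carries E d" "E \<subseteq> E'" "finite E'" shows "carries E' d"
proof -
  obtain f where f: "\<forall>e. 0 \<le> f e" "\<forall>v. d v = (\<Sum>e\<in>E. f e * bd e v)"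
    using assms unfolding carries_def by blast
  have "(\<Sum>e\<in>E. f e * bd e v) = (\<Sum>e\<in>E'. (if e \<in> E then f e else 0) * bd e v)" for v
    by (rule sum.mono_neutral_cong_left) (use assms in auto)
  with f show ?thesis
    unfolding carries_def by (intro exI[of _ "\<lambda>e. if e \<in> E then f e else 0"]) simp
qed

text \<open>Moving the smaller of the flows on \<open>(i, j)\<close> and \<open>(j, k)\<close> to
  \<open>(i, k)\<close> preserves the boundary and empties one of the two edges. The flow is first
  extended by zero if \<open>(i, k)\<close> is not yet in \<open>E\<close>.\<close>

lemma carries_reduce:
  assumes E: "finite E" "(i, j) \<in> E" "(j, k) \<in> E" "i < j" "j < k" and "carries E d"
  shows "carries (insert (i, k) (E - {(j, k)})) d \<or> carries (insert (i, k) (E - {(i, j)})) d"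
proof -
  obtain f where f: "\<And>e. 0 \<le> f e" "\<And>v. d v = (\<Sum>e\<in>insert (i, k) E. f e * bd e v)"
    using carries_mono[OF \<open>carries E d\<close>, of "insert (i, k) E"] E(1) unfolding carries_def by blast
  define c where "c = min (f (i, j)) (f (j, k))"
  define g where "g e = f e + ((if e = (i, k) then c else 0) - (if e = (i, j) then c else 0)
    - (if e = (j, k) then c else 0))" for e
  have g_nonneg: "0 \<le> g e" for e
    using f(1)[of e] f(1)[of "(i, j)"] f(1)[of "(j, k)"] E(4,5) by (auto simp: g_def c_def)
  have delta: "(\<Sum>e\<in>insert (i, k) E. (if e = e0 then c else 0) * bd e v) = c * bd e0 v"
    if "e0 \<in> insert (i, k) E" for e0 v
    using E(1) that by (simp add: if_distrib[of "\<lambda>t. t * _"] sum.delta cong: if_cong del: insert_iff sum.insert_if)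
  have g_sum: "d v = (\<Sum>e\<in>insert (i, k) E. g e * bd e v)" for v
  proof -
    have "(\<Sum>e\<in>insert (i, k) E. g e * bd e v) =
      (\<Sum>e\<in>insert (i, k) E. f e * bd e v) + (c * bd (i, k) v - c * bd (i, j) v - c * bd (j, k) v)"
      using E(2,3) unfolding g_def distrib_right left_diff_distrib sum.distrib sum_subtractf
      by (simp only: delta insert_iff simp_thms)
    also have "c * bd (i, k) v - c * bd (i, j) v - c * bd (j, k) v = 0"
      by (simp add: bd_def algebra_simps)
    finally show ?thesis using f(2) by simp
  qed
  have drop: "carries (insert (i, k) (E - {e0})) d" if "g e0 = 0" "e0 \<noteq> (i, k)" for e0
    unfolding carries_def
  proof (intro exI[of _ g] conjI allI g_nonneg)
    show "d v = (\<Sum>e\<in>insert (i, k) (E - {e0}). g e * bd e v)" for v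
      unfolding g_sum using that E(1) by (intro sum.mono_neutral_right) auto
  qed
  have "g (i, j) = 0 \<or> g (j, k) = 0"
    using E(4,5) by (auto simp: g_def c_def min_def)
  then show ?thesis
    using drop[of "(i, j)"] drop[of "(j, k)"] E(4,5) by auto
qed

lemma sum_bd:
  assumes "finite E"
  shows "(\<Sum>e\<in>E. f e * bd e v) = (\<Sum>e | e \<in> E \<and> fst e = v. f e) - (\<Sum>e | e \<in> E \<and> snd e = v. f e)"
proof -
  have "(\<Sum>e\<in>E. f e * bd e v) = (\<Sum>e\<in>E. (if fst e = v then f e else 0) - (if snd e = v then f e else 0))"
    by (rule sum.cong) (auto simp: bd_def)
  then show ?thesis using assms by (simp add: sum_subtractf sum.inter_filter)
qed

definition arc_pairs :: "nat set \<Rightarrow> nat set \<Rightarrow> (nat \<times> nat) set" where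
  "arc_pairs I K = {(a, b). a \<in> I \<and> b \<in> K \<and> a \<le> b}"

text \<open>The loop at \<open>v\<close> stands for the route \<open>s\<close>, \<open>v\<close>,
  \<open>t\<close>, which uses no edge of \<open>G\<close>.\<close>

definition loops :: "nat set \<Rightarrow> (nat \<times> nat) set" where
  "loops B = {(v, v) | v. v \<in> B}"

lemma finite_arc_pairs: "finite I \<Longrightarrow> finite K \<Longrightarrow> finite (arc_pairs I K)"
  by (rule finite_subset[of _ "I \<times> K"]) (auto simp: arc_pairs_def)

text \<open>The absence of consecutive edges excludes \<open>b = a'\<close>, the only case that
  separates \<open>planar\<close> from \<open>noncrossing\<close>. If one of the two pairs is a
  loop, the condition holds at once.\<close>

lemma noncrossing_Un_loops:
  assumes "planar E" "\<And>a b. (a, b) \<in> E \<Longrightarrow> a < b"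
    and nopath: "\<And>i j k. (i, j) \<in> E \<Longrightarrow> (j, k) \<notin> E"
  shows "noncrossing (E \<union> loops B)"
  unfolding noncrossing_def
proof (intro allI impI)
  fix a b a' b' assume *: "(a, b) \<in> E \<union> loops B" "(a', b') \<in> E \<union> loops B" "a < a'" "b < b'"
  show "b < a'"
  proof (cases "(a, b) \<in> E \<and> (a', b') \<in> E")
    case True
    then have "b \<le> a'" using planarD[OF assms(1)] * by blast
    moreover have "b \<noteq> a'" using True nopath by blast
    ultimately show ?thesis by simp
  next
    case False
    then show ?thesis using * by (auto simp: loops_def)
  qed
qed

text \<open>In a reduced graph each vertex is a source or a sink, so the part of its in- and outflow
  that the edges do not carry is the same, and the loop at that vertex can take it.\<close>

lemma support_subset_if_carries:
  fixes w :: "nat \<times> nat \<Rightarrow> real"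
  assumes fin: "finite I" "finite K"
    and E: "E \<subseteq> {(a, b). a \<in> I \<and> b \<in> K \<and> a < b}" "planar E"
    and nopath: "\<And>i j k. (i, j) \<in> E \<Longrightarrow> (j, k) \<notin> E"
    and w: "\<And>e. e \<in> arc_pairs I K \<Longrightarrow> 0 \<le> w e" "noncrossing {e \<in> arc_pairs I K. w e \<noteq> 0}"
    and car: "carries E (\<lambda>v. \<Sum>e\<in>arc_pairs I K. w e * bd e v)"
  shows "{e \<in> arc_pairs I K. w e \<noteq> 0} \<subseteq> E \<union> loops (I \<inter> K)"
proof -
  let ?P = "arc_pairs I K"
  note finP = finite_arc_pairs[OF fin]
  have EP: "E \<subseteq> ?P" using E(1) by (auto simp: arc_pairs_def)
  have finE: "finite E" using finP EP finite_subset by blast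
  obtain f where f: "\<And>e. 0 \<le> f e" "\<And>v. (\<Sum>e\<in>?P. w e * bd e v) = (\<Sum>e\<in>E. f e * bd e v)"
    using car unfolding carries_def by blast
  define outw where "outw v = (\<Sum>e | e \<in> ?P \<and> fst e = v. w e)" for v
  define inw where "inw v = (\<Sum>e | e \<in> ?P \<and> snd e = v. w e)" for v
  define outf where "outf v = (\<Sum>e | e \<in> E \<and> fst e = v. f e)" for v
  define inf where "inf v = (\<Sum>e | e \<in> E \<and> snd e = v. f e)" for v
  have bal: "outw v - inw v = outf v - inf v" for v
    using f(2)[of v] unfolding sum_bd[OF finP] sum_bd[OF finE] outw_def inw_def outf_def inf_def .
  have nn: "0 \<le> outw v" "0 \<le> inw v" for v
    unfolding outw_def inw_def using w(1) by (auto intro!: sum_nonneg)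
  \<comment> \<open>The outflow at \<open>v\<close> that \<open>E\<close> does not carry; by
    \<open>bal\<close> it is also the inflow at \<open>v\<close> that \<open>E\<close> does not
    carry.\<close>
  define l where "l v = outw v - outf v" for v
  have l_nonneg: "0 \<le> l v" for v
  proof (cases "\<exists>k. (v, k) \<in> E")
    case True
    then have "{e. e \<in> E \<and> snd e = v} = {}" using nopath by auto
    then have "inf v = 0" unfolding inf_def by (simp only: sum.empty)
    then show ?thesis using bal[of v] nn(2)[of v] by (simp add: l_def)
  next
    case False
    then have "{e. e \<in> E \<and> fst e = v} = {}" by auto
    then have "outf v = 0" unfolding outf_def by (simp only: sum.empty)
    then show ?thesis using nn(1)[of v] by (simp add: l_def)
  qed
  define w' where "w' e = (if e \<in> E then f e else 0) + (if fst e = snd e then l (fst e) else 0)" for e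
  have sumE: "(\<Sum>e | e \<in> ?P \<and> g e = v. if e \<in> E then f e else 0) = (\<Sum>e | e \<in> E \<and> g e = v. f e)"
    for g :: "nat \<times> nat \<Rightarrow> nat" and v
    by (rule sum.mono_neutral_cong_right) (use finP EP in auto)
  have sumL: "(\<Sum>e | e \<in> ?P \<and> g e = v. if fst e = snd e then l (fst e) else 0) =
      (if v \<in> I \<inter> K then l v else 0)" if g: "g = fst \<or> g = snd" for g v
  proof -
    have "(\<Sum>e | e \<in> ?P \<and> g e = v. if fst e = snd e then l (fst e) else 0) =
        (\<Sum>e\<in>(if v \<in> I \<inter> K then {(v, v)} else {}). l (fst e))"
      by (rule sum.mono_neutral_cong_right) (use finP g in \<open>auto simp: arc_pairs_def split: if_splits\<close>)
    then show ?thesis by simp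
  qed
  \<comment> \<open>Off \<open>I \<inter> K\<close> no loop is available, but there
    \<open>l v\<close> is zero: directly if \<open>v\<close> is not in \<open>I\<close>, and by
    \<open>bal\<close> if \<open>v\<close> is not in \<open>K\<close>.\<close>
  have outside: "v \<notin> I \<Longrightarrow> outw v = 0 \<and> outf v = 0" "v \<notin> K \<Longrightarrow> inw v = 0 \<and> inf v = 0" for v
    unfolding outw_def outf_def inw_def inf_def using E(1)
    by (auto simp: arc_pairs_def intro!: sum.neutral)
  have nc': "noncrossing {e \<in> ?P. w' e \<noteq> 0}"
  proof (rule noncrossing_subset)
    show "noncrossing (E \<union> loops (I \<inter> K))"
      by (rule noncrossing_Un_loops[OF E(2) _ nopath]) (use E(1) in auto)
    show "{e \<in> ?P. w' e \<noteq> 0} \<subseteq> E \<union> loops (I \<inter> K)"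
      by (auto simp: w'_def arc_pairs_def loops_def split: if_splits)
  qed
  have eq: "w e = w' e" if "e \<in> ?P" for e
  proof (rule noncrossing_weights_unique[OF finP _ w(1) _ w(2) nc' _ _ that])
    show "a \<le> b" if "(a, b) \<in> ?P" for a b using that by (simp add: arc_pairs_def)
    show "0 \<le> w' e" for e using f(1) l_nonneg by (simp add: w'_def)
    show "(\<Sum>e | e \<in> ?P \<and> fst e = v. w e) = (\<Sum>e | e \<in> ?P \<and> fst e = v. w' e)" for v
    proof -
      have "(\<Sum>e | e \<in> ?P \<and> fst e = v. w' e) = outf v + (if v \<in> I \<inter> K then l v else 0)"
        unfolding w'_def sum.distrib sumE sumL[OF disjI1[OF refl]] outf_def ..
      also have "\<dots> = outw v"
        using outside[of v] bal[of v] by (auto simp: l_def)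
      finally show ?thesis by (simp add: outw_def)
    qed
    show "(\<Sum>e | e \<in> ?P \<and> snd e = v. w e) = (\<Sum>e | e \<in> ?P \<and> snd e = v. w' e)" for v
    proof -
      have "(\<Sum>e | e \<in> ?P \<and> snd e = v. w' e) = inf v + (if v \<in> I \<inter> K then l v else 0)"
        unfolding w'_def sum.distrib sumE sumL[OF disjI2[OF refl]] inf_def ..
      also have "\<dots> = inw v"
        using outside[of v] bal[of v] by (auto simp: l_def)
      finally show ?thesis by (simp add: inw_def)
    qed
  qed
  show ?thesis
    using eq by (auto simp: w'_def arc_pairs_def loops_def split: if_splits)
qed

subsection \<open>The length reduction order\<close>

definition mono_var :: "var \<Rightarrow> monomial" where
  "mono_var v = Poly_Mapping.single v 1"

text \<open>Multiplicities are forgotten: planarity and the flows that a graph carries depend only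
  on which edges occur.\<close>

definition edges :: "monomial \<Rightarrow> (nat \<times> nat) set" where
  "edges M = {(a, b). var_dvd (X a b) M}"

lemma mem_edges_iff: "(a, b) \<in> edges M \<longleftrightarrow> var_dvd (X a b) M"
  by (simp add: edges_def)

lemma finite_edges: "finite (edges M)"
proof (rule finite_imageD)
  show "finite ((\<lambda>(a, b). X a b) ` edges M)"
    by (rule finite_subset[OF _ finite_keys[of M]])
      (auto simp: edges_def var_dvd_def in_keys_iff)
qed (auto simp: inj_on_def)

lemma var_dvd_add: "var_dvd v (M + N) \<longleftrightarrow> var_dvd v M \<or> var_dvd v N"
  by (auto simp: var_dvd_def lookup_add)

lemma var_dvd_mono_var: "var_dvd v (mono_var u) \<longleftrightarrow> u = v"
  by (auto simp: var_dvd_def mono_var_def lookup_single when_def)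

lemma edges_add: "edges (M + N) = edges M \<union> edges N"
  by (auto simp: edges_def var_dvd_add)

lemma edges_X: "edges (mono_var (X a b)) = {(a, b)}"
  by (auto simp: edges_def var_dvd_mono_var)

lemma edges_Beta: "edges (mono_var Beta) = {}"
  by (auto simp: edges_def var_dvd_mono_var)

lemma graph_monomial_eq:
  assumes "finite E"
  shows "graph_monomial E = Poly_Mapping.single (\<Sum>(a, b)\<in>E. mono_var (X a b)) 1"
  using assms unfolding graph_monomial_def
  by (induction E rule: finite_induct) (auto simp: pvar_def mult_single mono_var_def)

lemma edges_sum:
  assumes "finite E"
  shows "edges (\<Sum>(a, b)\<in>E. mono_var (X a b)) = E"
    and "\<not> var_dvd Beta (\<Sum>(a, b)\<in>E. mono_var (X a b))"
proof -
  have "edges (\<Sum>(a, b)\<in>E. mono_var (X a b)) = E \<and> \<not> var_dvd Beta (\<Sum>(a, b)\<in>E. mono_var (X a b))"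
    using assms
  proof (induction E rule: finite_induct)
    case empty
    show ?case by (simp add: edges_def var_dvd_def)
  next
    case (insert e E)
    then show ?case by (cases e) (simp add: edges_add edges_X var_dvd_add var_dvd_mono_var)
  qed
  then show "edges (\<Sum>(a, b)\<in>E. mono_var (X a b)) = E"
    and "\<not> var_dvd Beta (\<Sum>(a, b)\<in>E. mono_var (X a b))" by blast+
qed

text \<open>The three terms that replace \<open>N + mono_var (X i j) + mono_var (X j k)\<close>: all
  gain \<open>(i, k)\<close>, while of the two reduced factors the first keeps
  \<open>(i, j)\<close>, the second \<open>(j, k)\<close> and the third neither.\<close>

definition child_left :: "monomial \<Rightarrow> nat \<Rightarrow> nat \<Rightarrow> nat \<Rightarrow> monomial" where
  "child_left N i j k = N + mono_var (X i k) + mono_var (X i j)"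

definition child_right :: "monomial \<Rightarrow> nat \<Rightarrow> nat \<Rightarrow> nat \<Rightarrow> monomial" where
  "child_right N i j k = N + mono_var (X j k) + mono_var (X i k)"

definition child_beta :: "monomial \<Rightarrow> nat \<Rightarrow> nat \<Rightarrow> monomial" where
  "child_beta N i k = N + mono_var Beta + mono_var (X i k)"

lemma edges_children:
  "edges (child_left N i j k) = edges N \<union> {(i, k), (i, j)}"
  "edges (child_right N i j k) = edges N \<union> {(j, k), (i, k)}"
  "edges (child_beta N i k) = edges N \<union> {(i, k)}"
  by (auto simp: child_left_def child_right_def child_beta_def edges_add edges_X edges_Beta)

lemma Beta_children:
  "var_dvd Beta (child_left N i j k) \<longleftrightarrow> var_dvd Beta N"
  "var_dvd Beta (child_right N i j k) \<longleftrightarrow> var_dvd Beta N"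
  by (auto simp: child_left_def child_right_def var_dvd_add var_dvd_mono_var)

text \<open>Coefficients stay non-negative, so that no cancellation occurs and reductions act on
  the sets of monomials.\<close>

lemma length_stepE:
  assumes step: "length_step p q" and pos: "\<And>m. 0 \<le> Poly_Mapping.lookup p m"
  obtains M i j k N where "M \<in> Poly_Mapping.keys p" "longest_pair M i j k"
    "M = N + mono_var (X i j) + mono_var (X j k)"
    "Poly_Mapping.keys q = (Poly_Mapping.keys p - {M}) \<union>
       {child_left N i j k, child_right N i j k, child_beta N i k}"
    "\<forall>m. 0 \<le> Poly_Mapping.lookup q m"
proof -
  from step obtain M i j k N where M: "M \<in> Poly_Mapping.keys p" and lp: "longest_pair M i j k"
    and N: "M = N + mono_var (X i j) + mono_var (X j k)"
    and q: "q = p - Poly_Mapping.single M (Poly_Mapping.lookup p M)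
        + Poly_Mapping.single N (Poly_Mapping.lookup p M) *
          (pvar (X i k) * pvar (X i j) + pvar (X j k) * pvar (X i k) + pvar Beta * pvar (X i k))"
    unfolding length_step_def reduction_at_def mono_var_def by blast
  define c where "c = Poly_Mapping.lookup p M"
  have c: "c > 0" using M pos[of M] by (simp add: c_def in_keys_iff)
  let ?L = "child_left N i j k" and ?R = "child_right N i j k" and ?B = "child_beta N i k"
  have q': "q = p - Poly_Mapping.single M c + (Poly_Mapping.single ?L c
      + Poly_Mapping.single ?R c + Poly_Mapping.single ?B c)"
    unfolding q c_def[symmetric] child_left_def child_right_def child_beta_def pvar_def mono_var_def
    by (simp add: distrib_left mult_single add.assoc)
  \<comment> \<open>The contributions are added because children may coincide with one another or
    with monomials of \<open>p\<close>.\<close>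
  have lq: "Poly_Mapping.lookup q m = (if m = M then 0 else Poly_Mapping.lookup p m)
      + (if m = ?L then c else 0) + (if m = ?R then c else 0) + (if m = ?B then c else 0)" for m
    unfolding q' by (auto simp: lookup_add lookup_minus lookup_single when_def c_def)
  have "Poly_Mapping.keys q = (Poly_Mapping.keys p - {M}) \<union> {?L, ?R, ?B}"
  proof (rule set_eqI)
    fix m
    show "m \<in> Poly_Mapping.keys q \<longleftrightarrow> m \<in> (Poly_Mapping.keys p - {M}) \<union> {?L, ?R, ?B}"
      using pos[of m] c unfolding in_keys_iff lq Un_iff Diff_iff by auto
  qed
  moreover have "\<forall>m. 0 \<le> Poly_Mapping.lookup q m"
    using pos c unfolding lq by auto
  ultimately show thesis using that[OF M lp N] by blast
qed

lemma longest_pairD: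
  assumes "longest_pair M i j k"
  shows "i < j" "j < k" "(i, j) \<in> edges M" "(j, k) \<in> edges M"
    "\<And>i'. (i', j) \<in> edges M \<Longrightarrow> i \<le> i'" "\<And>k'. (j, k') \<in> edges M \<Longrightarrow> k' \<le> k"
  using assms by (auto simp: longest_pair_def is_pair_def edges_def not_less[symmetric])

lemma edges_parent: "edges (N + mono_var (X i j) + mono_var (X j k)) = edges N \<union> {(i, j), (j, k)}"
  by (auto simp: edges_add edges_X)

text \<open>\<open>Q\<close> is to contain all edges that arise, and transitivity accounts for the
  new edge \<open>(i, k)\<close>. The bound \<open>n\<close> on the vertices serves to prove
  termination.\<close>

locale reduction =
  fixes Q :: "(nat \<times> nat) set" and n :: nat
  assumes trans_Q: "trans Q" and Q_le: "\<And>a b. (a, b) \<in> Q \<Longrightarrow> b \<le> n"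
begin

definition good :: "subdiv_poly \<Rightarrow> bool" where
  "good p \<longleftrightarrow> (\<forall>m. 0 \<le> Poly_Mapping.lookup p m) \<and>
     (\<forall>M\<in>Poly_Mapping.keys p. edges M \<subseteq> Q \<and> planar (edges M))"

lemma good_nonneg: "good p \<Longrightarrow> 0 \<le> Poly_Mapping.lookup p m"
  unfolding good_def by blast

lemma good_edges: "good p \<Longrightarrow> M \<in> Poly_Mapping.keys p \<Longrightarrow> edges M \<subseteq> Q \<and> planar (edges M)"
  unfolding good_def by blast

text \<open>The graph of each child lies in that of its parent with \<open>(i, k)\<close> added,
  which is planar by \<open>planar_insert_longest\<close>. Here the choice of a longest pair
  enters.\<close>

lemma good_step:
  assumes "length_step p q" "good p" shows "good q"
proof -
  obtain M i j k N where st: "M \<in> Poly_Mapping.keys p" "longest_pair M i j k"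
    "M = N + mono_var (X i j) + mono_var (X j k)"
    "Poly_Mapping.keys q = (Poly_Mapping.keys p - {M}) \<union>
       {child_left N i j k, child_right N i j k, child_beta N i k}"
    "\<forall>m. 0 \<le> Poly_Mapping.lookup q m"
    by (rule length_stepE[OF assms(1) good_nonneg[OF assms(2)]])
  note lp = longest_pairD[OF st(2)]
  have M: "edges M \<subseteq> Q" "planar (edges M)" using good_edges[OF assms(2) st(1)] by blast+
  have pl: "planar (insert (i, k) (edges M))"
    by (rule planar_insert_longest[OF M(2) lp(3,4,1,2,5,6)])
  have "(i, k) \<in> Q" using transD[OF trans_Q subsetD[OF M(1) lp(3)] subsetD[OF M(1) lp(4)]] .
  then have Q: "insert (i, k) (edges M) \<subseteq> Q" using M(1) by blast
  have sub: "edges M' \<subseteq> insert (i, k) (edges M)"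
    if "M' = child_left N i j k \<or> M' = child_right N i j k \<or> M' = child_beta N i k" for M'
    using that unfolding st(3) edges_parent by (elim disjE) (simp_all add: edges_children, blast+)
  have "edges M' \<subseteq> Q \<and> planar (edges M')" if "M' \<in> Poly_Mapping.keys q" for M'
  proof (cases "M' \<in> Poly_Mapping.keys p")
    case True
    then show ?thesis by (rule good_edges[OF assms(2)])
  next
    case False
    then have "edges M' \<subseteq> insert (i, k) (edges M)"
      using that unfolding st(4) by (intro sub) blast
    then show ?thesis using planar_subset[OF pl] Q by blast
  qed
  then show ?thesis using st(5) unfolding good_def by blast
qed

definition covers :: "subdiv_poly \<Rightarrow> (nat \<Rightarrow> real) \<Rightarrow> bool" where
  "covers p d \<longleftrightarrow> (\<exists>M\<in>Poly_Mapping.keys p. \<not> var_dvd Beta M \<and> carries (edges M) d)"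

lemma coversI: "M \<in> Poly_Mapping.keys p \<Longrightarrow> \<not> var_dvd Beta M \<Longrightarrow> carries (edges M) d \<Longrightarrow> covers p d"
  unfolding covers_def by blast

text \<open>If the reduced monomial carries \<open>d\<close>, then \<open>carries_reduce\<close>
  passes \<open>d\<close> on to the left or the right child, and both are free of
  \<open>Beta\<close> when the parent is.\<close>

lemma covers_step:
  assumes "length_step p q" "good p" "covers p d" shows "covers q d"
proof -
  obtain M i j k N where st: "M \<in> Poly_Mapping.keys p" "longest_pair M i j k"
    "M = N + mono_var (X i j) + mono_var (X j k)"
    "Poly_Mapping.keys q = (Poly_Mapping.keys p - {M}) \<union>
       {child_left N i j k, child_right N i j k, child_beta N i k}"
    "\<forall>m. 0 \<le> Poly_Mapping.lookup q m"
    by (rule length_stepE[OF assms(1) good_nonneg[OF assms(2)]])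
  note lp = longest_pairD[OF st(2)]
  obtain M' where M': "M' \<in> Poly_Mapping.keys p" "\<not> var_dvd Beta M'" "carries (edges M') d"
    using assms(3) unfolding covers_def by blast
  show ?thesis
  proof (cases "M' = M")
    case False
    then have "M' \<in> Poly_Mapping.keys q" using M'(1) unfolding st(4) by blast
    then show ?thesis using M'(2,3) by (rule coversI)
  next
    case True
    have nb: "\<not> var_dvd Beta N" using M'(2) unfolding True st(3) var_dvd_add by blast
    have "carries (edges M) d" using M'(3) True by simp
    from carries_reduce[OF finite_edges lp(3,4,1,2) this]
    show ?thesis
    proof
      assume *: "carries (insert (i, k) (edges M - {(j, k)})) d"
      have "carries (edges (child_left N i j k)) d"
        by (rule carries_mono[OF * _ finite_edges]) (unfold st(3) edges_parent edges_children, blast)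
      then show ?thesis
        by (rule coversI[rotated 2]) (unfold st(4), blast, unfold Beta_children, rule nb)
    next
      assume *: "carries (insert (i, k) (edges M - {(i, j)})) d"
      have "carries (edges (child_right N i j k)) d"
        by (rule carries_mono[OF * _ finite_edges]) (unfold st(3) edges_parent edges_children, blast)
      then show ?thesis
        by (rule coversI[rotated 2]) (unfold st(4), blast, unfold Beta_children, rule nb)
    qed
  qed
qed

lemma good_covers_steps:
  assumes "length_step\<^sup>*\<^sup>* p q" "good p"
  shows "good q \<and> (\<forall>d. covers p d \<longrightarrow> covers q d)"
  using assms
proof (induction rule: rtranclp_induct)
  case base
  then show ?case by simp
next
  case (step y z)
  then have y: "good y" "\<And>d. covers p d \<Longrightarrow> covers y d" by blast+
  show ?case
    using good_step[OF step(2) y(1)] covers_step[OF step(2) y(1) y(2)] by blast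
qed

text \<open>Reductions replace edges by longer ones, each of smaller cost.\<close>

definition cost :: "monomial \<Rightarrow> nat" where
  "cost M = (\<Sum>(a, b)\<in>{..n} \<times> {..n}. Poly_Mapping.lookup M (X a b) * (n + 1 + a - b))"

lemma cost_add: "cost (M + N) = cost M + cost N"
  by (simp add: cost_def lookup_add distrib_right sum.distrib case_prod_unfold)

lemma cost_X:
  assumes "a \<le> n" "b \<le> n"
  shows "cost (mono_var (X a b)) = n + 1 + a - b"
proof -
  have "cost (mono_var (X a b)) = (\<Sum>e\<in>{..n} \<times> {..n}. if e = (a, b) then n + 1 + a - b else 0)"
    unfolding cost_def by (rule sum.cong) (auto simp: mono_var_def lookup_single when_def split: if_splits)
  also have "\<dots> = n + 1 + a - b" using assms by simp
  finally show ?thesis .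
qed

lemma cost_Beta: "cost (mono_var Beta) = 0"
  by (auto simp: cost_def mono_var_def lookup_single when_def intro!: sum.neutral)

text \<open>A monomial of cost \<open>c\<close> gives way to at most three of cost below
  \<open>c\<close>, whose weights add up to at most \<open>3 * 4 ^ (c - 1) < 4 ^ c\<close>.
  Coinciding monomials only make the new sum smaller.\<close>

lemma cost_step:
  assumes "length_step p q" "good p"
  shows "(\<Sum>M\<in>Poly_Mapping.keys q. 4 ^ cost M) < (\<Sum>M\<in>Poly_Mapping.keys p. (4::nat) ^ cost M)"
proof -
  obtain M i j k N where st: "M \<in> Poly_Mapping.keys p" "longest_pair M i j k"
    "M = N + mono_var (X i j) + mono_var (X j k)"
    "Poly_Mapping.keys q = (Poly_Mapping.keys p - {M}) \<union>
       {child_left N i j k, child_right N i j k, child_beta N i k}"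
    "\<forall>m. 0 \<le> Poly_Mapping.lookup q m"
    by (rule length_stepE[OF assms(1) good_nonneg[OF assms(2)]])
  note lp = longest_pairD[OF st(2)]
  let ?L = "child_left N i j k" and ?R = "child_right N i j k" and ?B = "child_beta N i k"
  have "(j, k) \<in> Q" using lp(4) good_edges[OF assms(2) st(1)] by blast
  then have "k \<le> n" by (rule Q_le)
  with lp(1,2) have le: "i \<le> n" "j \<le> n" "k \<le> n" by linarith+
  have lt: "cost ?L < cost M" "cost ?R < cost M" "cost ?B < cost M"
    unfolding child_left_def child_right_def child_beta_def st(3) cost_add
      cost_X[OF le(1,2)] cost_X[OF le(2,3)] cost_X[OF le(1,3)] cost_Beta
    using lp(1,2) le by linarith+
  have small: "4 * (4::nat) ^ cost M' \<le> 4 ^ cost M" if "cost M' < cost M" for M'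
    using power_increasing[of "Suc (cost M')" "cost M" "4::nat"] that by simp
  let ?S = "\<Sum>M\<in>Poly_Mapping.keys p - {M}. (4::nat) ^ cost M"
  have "(\<Sum>M\<in>Poly_Mapping.keys q. (4::nat) ^ cost M) \<le> ?S + (\<Sum>M\<in>{?L, ?R, ?B}. 4 ^ cost M)"
    unfolding st(4) by (subst sum_Un_nat) simp_all
  moreover have "(\<Sum>M\<in>{?L, ?R, ?B}. (4::nat) ^ cost M) \<le> 4 ^ cost ?L + 4 ^ cost ?R + 4 ^ cost ?B"
    by (simp add: sum.insert_if)
  moreover have "4 ^ cost ?L + 4 ^ cost ?R + 4 ^ cost ?B < (4::nat) ^ cost M"
    using small[OF lt(1)] small[OF lt(2)] small[OF lt(3)] zero_less_power[of "4::nat" "cost M"]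
    by linarith
  moreover have "(\<Sum>M\<in>Poly_Mapping.keys p. (4::nat) ^ cost M) = 4 ^ cost M + ?S"
    by (rule sum.remove[OF finite_keys st(1)])
  ultimately show ?thesis by linarith
qed

text \<open>With \<open>j\<close> the least middle vertex of a pair, the least tail of an edge into
  \<open>j\<close> and the greatest head of an edge out of \<open>j\<close> form a longest
  pair.\<close>

lemma exists_step:
  assumes "\<not> is_reduced p"
  shows "\<exists>q. length_step p q"
proof -
  obtain M i0 j0 k0 where M: "M \<in> Poly_Mapping.keys p" "is_pair M i0 j0 k0"
    using assms unfolding is_reduced_def by blast
  define j where "j = (LEAST j. \<exists>i k. is_pair M i j k)"
  have "\<exists>i k. is_pair M i j k" unfolding j_def by (rule LeastI_ex) (use M(2) in blast)
  then obtain i1 k1 where j: "is_pair M i1 j k1" by blast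
  have jp: "i1 < j" "j < k1" "var_dvd (X i1 j) M" "var_dvd (X j k1) M"
    using j unfolding is_pair_def by blast+
  define i where "i = (LEAST i. var_dvd (X i j) M)"
  have i: "var_dvd (X i j) M" "i \<le> i1"
    unfolding i_def using jp(3) by (rule LeastI, rule Least_le)
  have i_least: "\<not> var_dvd (X i' j) M" if "i' < i" for i'
    using that not_less_Least unfolding i_def by blast
  define K where "K = {k. var_dvd (X j k) M}"
  have "K \<subseteq> snd ` edges M" by (force simp: K_def edges_def)
  then have "finite K" using finite_edges finite_surj by blast
  moreover have "k1 \<in> K" using jp(4) by (simp add: K_def)
  ultimately have "Max K \<in> K" and k: "k1 \<le> Max K" "\<And>k'. k' \<in> K \<Longrightarrow> k' \<le> Max K"
    using Max_in[of K] Max_ge[of K] by blast+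
  define k where "k = Max K"
  have k_dvd: "var_dvd (X j k) M" using \<open>Max K \<in> K\<close> unfolding k_def K_def by blast
  have ijk: "i < j" "j < k" using i(2) jp(1,2) k(1) unfolding k_def by linarith+
  have k_greatest: "\<not> var_dvd (X j k') M" if "k' > k" for k'
    using that k(2)[of k'] unfolding k_def K_def by auto
  have lp: "longest_pair M i j k"
    unfolding longest_pair_def is_pair_def
    using i(1) ijk k_dvd i_least k_greatest by blast
  define N where "N = M - mono_var (X i j) - mono_var (X j k)"
  have ge: "1 \<le> Poly_Mapping.lookup M (X i j)" "1 \<le> Poly_Mapping.lookup M (X j k)"
    using i(1) k_dvd unfolding var_dvd_def .
  have "M = N + mono_var (X i j) + mono_var (X j k)"
    unfolding N_def using ge ijk
    by (intro poly_mapping_eqI)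
      (auto simp: mono_var_def lookup_add lookup_minus lookup_single when_def)
  then have "\<exists>q. reduction_at M i j k p q"
    unfolding reduction_at_def mono_var_def using M(1) ijk by blast
  moreover have "\<forall>j'<j. \<not> (\<exists>i' k'. is_pair M i' j' k')"
    using not_less_Least unfolding j_def by blast
  ultimately show ?thesis using lp unfolding length_step_def by blast
qed

lemma exists_reduced:
  assumes "good p"
  shows "\<exists>q. length_step\<^sup>*\<^sup>* p q \<and> is_reduced q"
  using assms
proof (induction "\<Sum>M\<in>Poly_Mapping.keys p. (4::nat) ^ cost M" arbitrary: p rule: less_induct)
  case less
  show ?case
  proof (cases "is_reduced p")
    case True then show ?thesis by blast
  next
    case False
    obtain p' where p': "length_step p p'" using exists_step[OF False] ..
    obtain q where "length_step\<^sup>*\<^sup>* p' q" "is_reduced q"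
      using less(1)[OF cost_step[OF p' less(2)] good_step[OF p' less(2)]] by blast
    then show ?thesis using converse_rtranclp_into_rtranclp[of length_step, OF p'] by blast
  qed
qed

lemma good_graph_monomial:
  assumes "finite E" "E \<subseteq> Q" "planar E"
  shows "good (graph_monomial E)"
  using assms edges_sum(1)[OF assms(1)] unfolding good_def graph_monomial_eq[OF assms(1)]
  by (simp add: lookup_single when_def)

lemma covers_graph_monomial:
  assumes "finite E" "carries E d"
  shows "covers (graph_monomial E) d"
  using assms edges_sum[OF assms(1)] unfolding covers_def graph_monomial_eq[OF assms(1)]
  by simp

end

subsection \<open>Paths and routes\<close>

lemma path_edges_Cons: "xs \<noteq> [] \<Longrightarrow> path_edges (x # xs) = (x, hd xs) # path_edges xs"
  by (cases xs) (simp_all add: path_edges_def)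

lemma path_edges_snoc: "xs \<noteq> [] \<Longrightarrow> path_edges (xs @ [y]) = path_edges xs @ [(last xs, y)]"
proof (induction xs)
  case (Cons x xs)
  then show ?case by (cases "xs = []") (simp_all add: path_edges_Cons, simp add: path_edges_def)
qed simp

lemma path_edges_map: "path_edges (map f xs) = map (map_prod f f) (path_edges xs)"
  by (simp add: path_edges_def zip_map_map map_tl[symmetric] map_prod_def)

text \<open>Reduces membership of an edge in a path to the vertex set of the path, which
  \<open>path_structure\<close> describes.\<close>

lemma path_edges_strict_sorted:
  fixes P :: "'a::linorder list"
  assumes "sorted_wrt (<) P"
  shows "(u, w) \<in> set (path_edges P) \<longleftrightarrow>
    u \<in> set P \<and> w \<in> set P \<and> u < w \<and> (\<forall>x\<in>set P. \<not> (u < x \<and> x < w))"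
  using assms
proof (induction P)
  case (Cons x P)
  show ?case
  proof (cases "P = []")
    case False
    then obtain y P' where P: "P = y # P'" by (cases P) auto
    have lt: "x < y" "\<forall>z\<in>set P'. y < z" "\<forall>z\<in>set P. x < z" using Cons.prems P by auto
    have IH: "(u, w) \<in> set (path_edges P) \<longleftrightarrow>
      u \<in> set P \<and> w \<in> set P \<and> u < w \<and> (\<forall>x\<in>set P. \<not> (u < x \<and> x < w))"
      using Cons by simp
    show ?thesis
    proof (cases "u = x")
      case True
      have "(u, w) \<notin> set (path_edges P)" unfolding IH using True lt(3) by auto
      then have "(u, w) \<in> set (path_edges (x # P)) \<longleftrightarrow> w = y"
        using True False P by (simp add: path_edges_Cons)
      also have "\<dots> \<longleftrightarrow> w \<in> set P \<and> (\<forall>z\<in>set P. \<not> z < w)"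
        using lt(2) P by force
      finally show ?thesis using True lt(3) by auto
    next
      case u: False
      then have "(u, w) \<in> set (path_edges (x # P)) \<longleftrightarrow> (u, w) \<in> set (path_edges P)"
        using False by (simp add: path_edges_Cons)
      also note IH
      finally show ?thesis using u lt(3) by auto
    qed
  qed (auto simp: path_edges_def)
qed (simp add: path_edges_def)

lemma path_edges_route:
  "P \<noteq> [] \<Longrightarrow> path_edges (Source # map V P @ [Sink]) =
    (Source, V (hd P)) # map (map_prod V V) (path_edges P) @ [(V (last P), Sink)]"
  by (simp add: path_edges_Cons path_edges_snoc path_edges_map hd_map last_map)

text \<open>By \<open>cut\<close>, every edge of \<open>G\<close> below has an end on the spine \<open>I \<inter> K\<close>.\<close>

locale caterpillar =
  fixes I K :: "nat set"
  assumes fin: "finite I" "finite K"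
    and cut: "\<And>a b. a \<in> I \<Longrightarrow> b \<in> K \<Longrightarrow> a \<le> b \<Longrightarrow> \<exists>c\<in>I \<inter> K. a \<le> c \<and> c \<le> b"
begin

definition G :: "(nat \<times> nat) set" where
  "G = {(a, b). a \<in> I \<and> b \<in> K \<and> a < b \<and> (\<forall>c\<in>I \<inter> K. \<not> (a < c \<and> c < b))}"

lemma G_D: "(a, b) \<in> G \<Longrightarrow> a \<in> I \<and> b \<in> K \<and> a < b" "(a, b) \<in> G \<Longrightarrow> c \<in> I \<inter> K \<Longrightarrow> a < c \<Longrightarrow> \<not> c < b"
  unfolding G_def by blast+

lemma finite_G: "finite G"
  by (rule finite_subset[of _ "I \<times> K"]) (use fin G_D in auto)

text \<open>If \<open>a' < b\<close>, then \<open>cut\<close> gives a spine vertex from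
  \<open>a'\<close> to \<open>b\<close>. It cannot lie strictly between \<open>a\<close> and
  \<open>b\<close>, so it is \<open>b\<close>; but then it lies strictly between \<open>a'\<close>
  and \<open>b'\<close>.\<close>

lemma planar_G: "planar G"
  unfolding planar_def
proof (intro allI impI)
  fix a b a' b' assume *: "(a, b) \<in> G" "(a', b') \<in> G" "a < a'" "b < b'"
  show "b \<le> a'"
  proof (rule ccontr)
    assume "\<not> b \<le> a'"
    then obtain c where c: "c \<in> I \<inter> K" "a' \<le> c" "c \<le> b"
      using cut[of a' b] G_D(1)[OF *(1)] G_D(1)[OF *(2)] by auto
    have "\<not> c < b" using G_D(2)[OF *(1) c(1)] c(2) *(3) by simp
    then have "c = b" using c(3) by simp
    then show False using G_D(2)[OF *(2) c(1)] \<open>\<not> b \<le> a'\<close> *(4) by simp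
  qed
qed

text \<open>Each inner vertex is the head of one edge and the tail of the next, hence on the spine.
  No edge jumps over a spine vertex, so none between \<open>a\<close> and \<open>b\<close> is
  missed.\<close>

lemma path_structure:
  assumes "dipath G a P b"
  shows "a \<le> b \<and> sorted_wrt (<) P \<and> set P = {a, b} \<union> (I \<inter> K \<inter> {a<..<b})"
  using assms
proof (induction P arbitrary: a)
  case Nil
  then show ?case by (simp add: dipath_def)
next
  case (Cons x P)
  show ?case
  proof (cases "P = []")
    case True
    then show ?thesis using Cons.prems by (auto simp: dipath_def)
  next
    case False
    define c where "c = hd P"
    have x: "x = a" and ac: "(a, c) \<in> G" and P: "dipath G c P b"
      using Cons.prems False by (auto simp: dipath_def c_def successively_Cons)
    note IH = Cons.IH[OF P]
    have lt: "a < c" "c \<in> K" using G_D(1)[OF ac] by auto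
    have "c \<in> I \<inter> K" if ne: "c \<noteq> b"
    proof -
      obtain y P' where P': "P = c # y # P'"
        using P ne by (cases P; cases "tl P") (auto simp: dipath_def)
      then have "(c, y) \<in> G" using P by (auto simp: dipath_def)
      then show ?thesis using G_D(1) lt(2) by blast
    qed
    then have "set (x # P) = {a, b} \<union> (I \<inter> K \<inter> {a<..<b})"
      using IH lt(1) G_D(2)[OF ac] x by (auto simp: not_less) (metis IntI le_neq_implies_less)+
    moreover have "sorted_wrt (<) (x # P)"
      using IH lt(1) x by auto
    ultimately show ?thesis using IH lt(1) by auto
  qed
qed

lemma path_unique: "dipath G a P b \<Longrightarrow> dipath G a P' b \<Longrightarrow> P = P'"
  using path_structure by (intro strict_sorted_equal) metis+

lemma dipath_Cons: "(a, c) \<in> G \<Longrightarrow> dipath G c P b \<Longrightarrow> dipath G a (a # P) b"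
  using path_structure[of c P b] G_D(1)[of a c] by (auto simp: dipath_def successively_Cons)

text \<open>From \<open>a\<close> proceed to the next spine vertex, or to \<open>b\<close> if there
  is none before it. Boundaries telescope along the path, so the same induction shows that
  \<open>G\<close> carries a unit flow from \<open>a\<close> to \<open>b\<close>.\<close>

lemma path_exists:
  assumes "a \<in> I" "b \<in> K" "a \<le> b"
  shows "(\<exists>P. dipath G a P b) \<and> carries G (bd (a, b))"
  using assms
proof (induction "b - a" arbitrary: a rule: less_induct)
  case less
  show ?case
  proof (cases "a = b")
    case True
    have "dipath G a [a] b" using True by (simp add: dipath_def)
    moreover have "bd (a, b) = (\<lambda>v. 0)" using True by (auto simp: bd_def)
    ultimately show ?thesis using carries_zero by auto
  next
    case False
    define C where "C = insert b (I \<inter> K \<inter> {a<..<b})"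
    define c where "c = Min C"
    have "finite C" "C \<noteq> {}" using fin by (auto simp: C_def)
    then have c: "c \<in> C" "\<And>x. x \<in> C \<Longrightarrow> c \<le> x" by (auto simp: c_def)
    have cC: "c \<in> K" "a < c" "c \<le> b" using c(1) less.prems False by (auto simp: C_def)
    have "\<not> (a < x \<and> x < c)" if "x \<in> I \<inter> K" for x
      using c(2)[of x] that cC(3) by (auto simp: C_def)
    then have ac: "(a, c) \<in> G"
      using cC less.prems(1) unfolding G_def by blast
    show ?thesis
    proof (cases "c = b")
      case True
      have "dipath G a [a, b] b" using ac True False by (simp add: dipath_def)
      then show ?thesis using carries_edge[OF finite_G ac] True by auto
    next
      case cb: False
      then have cI: "c \<in> I" "a < c" "c < b" using c(1) by (auto simp: C_def)
      then have IH: "\<exists>P. dipath G c P b" "carries G (bd (c, b))"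
        using less(1)[of c] less.prems by auto
      have "bd (a, b) = (\<lambda>v. bd (a, c) v + bd (c, b) v)" by (auto simp: bd_def)
      then have "carries G (bd (a, b))"
        using carries_add[OF carries_edge[OF finite_G ac] IH(2)] by simp
      then show ?thesis using IH(1) dipath_Cons[OF ac] by blast
    qed
  qed
qed

definition path :: "nat \<Rightarrow> nat \<Rightarrow> nat list" where
  "path a b = (THE P. dipath G a P b)"

lemma path_eq: "dipath G a P b \<Longrightarrow> path a b = P"
  unfolding path_def using path_unique by blast

lemma path: "(a, b) \<in> arc_pairs I K \<Longrightarrow> dipath G a (path a b) b"
  using path_exists[of a b] path_eq unfolding arc_pairs_def by auto

text \<open>The condition splits into one on \<open>a\<close> and one on \<open>b\<close>, so that
  exchanging end points of routes can be studied edge by edge.\<close>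

lemma mem_path_edges:
  assumes ab: "(a, b) \<in> arc_pairs I K" and uw: "(u, w) \<in> G"
  shows "(u, w) \<in> set (path_edges (path a b)) \<longleftrightarrow>
    (u = a \<or> u \<in> I \<inter> K \<and> a < u) \<and> (w = b \<or> w \<in> I \<inter> K \<and> w < b)"
proof -
  note st = path_structure[OF path[OF ab]]
  have uw': "u < w" "\<And>c. c \<in> I \<inter> K \<Longrightarrow> u < c \<Longrightarrow> \<not> c < w" using G_D[OF uw] by auto
  show ?thesis
    unfolding path_edges_strict_sorted[OF conjunct1[OF conjunct2[OF st]]]
    using st uw' by auto
qed

text \<open>Let \<open>c\<close> be a spine vertex with \<open>a' \<le> c \<le> b\<close>. If
  \<open>\<alpha>\<close> tells \<open>a\<close> from \<open>a'\<close>, then \<open>u < c\<close>;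
  if \<open>\<beta>\<close> tells \<open>b\<close> from \<open>b'\<close>, then
  \<open>c < w\<close>. Both together would put \<open>c\<close> strictly between the ends of an
  edge of \<open>G\<close>.\<close>

lemma uncross_coordinate:
  assumes ab: "(a, b) \<in> arc_pairs I K" "(a', b') \<in> arc_pairs I K" "a < a'" "a' \<le> b" "b < b'"
    and uw: "(u, w) \<in> G"
  defines "\<alpha> \<equiv> \<lambda>x. u = x \<or> u \<in> I \<inter> K \<and> x < u" and "\<beta> \<equiv> \<lambda>y. w = y \<or> w \<in> I \<inter> K \<and> y > w"
  shows "\<alpha> a = \<alpha> a' \<or> \<beta> b = \<beta> b'"
proof (rule ccontr)
  assume "\<not> ?thesis"
  then have ne: "\<alpha> a \<noteq> \<alpha> a'" "\<beta> b \<noteq> \<beta> b'" by blast+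
  obtain c where c: "c \<in> I \<inter> K" "a' \<le> c" "c \<le> b"
    using cut[of a' b] ab by (auto simp: arc_pairs_def)
  have "u < c" using ne(1) c ab(3) by (cases "u = c") (auto simp: \<alpha>_def)
  moreover have "c < w" using ne(2) c ab(5) by (cases "w = c") (auto simp: \<beta>_def)
  ultimately show False using G_D(2)[OF uw c(1)] by blast
qed

end

subsection \<open>The map prec\<close>

lemma node_less_simps [simp]:
  "Plain i < Bar j \<longleftrightarrow> i \<le> j" "Bar j < Plain i \<longleftrightarrow> j < i"
  "Plain i < Plain i' \<longleftrightarrow> i < i'" "Bar j < Bar j' \<longleftrightarrow> j < j'"
  by (auto simp: less_node_def)

lemma imm_precedes_iff:
  "imm_precedes I J (Plain i) (Bar j) \<longleftrightarrow> i \<in> I \<and> j \<in> J \<and> i \<le> j \<and>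
     (\<forall>i'\<in>I. \<not> (i < i' \<and> i' \<le> j)) \<and> (\<forall>j'\<in>J. \<not> (i \<le> j' \<and> j' < j))"
  unfolding imm_precedes_def nodes_def bex_Un by auto

lemma prec_eq: "imm_precedes I J (Plain i) (Bar j) \<Longrightarrow> prec I J j = i"
proof -
  assume i: "imm_precedes I J (Plain i) (Bar j)"
  have "(THE i. i \<in> I \<and> imm_precedes I J (Plain i) (Bar j)) = i"
  proof (rule the_equality)
    show "i \<in> I \<and> imm_precedes I J (Plain i) (Bar j)" using i by (simp add: imm_precedes_iff)
    fix i' assume "i' \<in> I \<and> imm_precedes I J (Plain i') (Bar j)"
    then show "i' = i" using i unfolding imm_precedes_iff by (metis nat_neq_iff)
  qed
  moreover have "\<exists>i\<in>I. imm_precedes I J (Plain i) (Bar j)" using i by (auto simp: imm_precedes_iff)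
  ultimately show ?thesis by (simp add: prec_def)
qed

lemma prec_cases:
  obtains "imm_precedes I J (Plain (prec I J j)) (Bar j)" | "prec I J j = j"
proof (cases "\<exists>i\<in>I. imm_precedes I J (Plain i) (Bar j)")
  case True
  then obtain i where i: "imm_precedes I J (Plain i) (Bar j)" by blast
  then show ?thesis using prec_eq[OF i] that(1) by simp
next
  case False
  then show ?thesis using that(2) unfolding prec_def by argo
qed

lemma prec_le: "prec I J j \<le> j"
  by (rule prec_cases[of I J j]) (simp_all add: imm_precedes_iff)

text \<open>An element \<open>i\<close> of \<open>I\<close> with
  \<open>prec I J j < i \<le> j\<close> would come between \<open>j\<close> and its immediate
  predecessor.\<close>

lemma le_prec_iff: "i \<in> I \<Longrightarrow> i \<le> prec I J j \<longleftrightarrow> i \<le> j"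
  by (rule prec_cases[of I J j]) (auto simp: imm_precedes_iff not_le[symmetric])

lemma less_prec: "j' \<in> J \<Longrightarrow> j' < j \<Longrightarrow> j' < prec I J j"
  by (rule prec_cases[of I J j]) (auto simp: imm_precedes_iff not_le[symmetric])

text \<open>For \<open>x < y\<close> in \<open>J\<close>, \<open>prec_le\<close> and
  \<open>less_prec\<close> give \<open>prec I J x \<le> x < prec I J y\<close>.\<close>

lemma prec_less_iff:
  assumes "j \<in> J" "j' \<in> J" shows "prec I J j < prec I J j' \<longleftrightarrow> j < j'"
proof -
  have lt: "prec I J x < prec I J y" if "x < y" "x \<in> J" for x y
    using prec_le[of I J x] less_prec[OF that(2,1), of I] by linarith
  show ?thesis
    using lt[of j j'] lt[of j' j] assms by (cases j j' rule: linorder_cases) auto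
qed

lemma inj_on_prec: "inj_on (prec I J) J"
  using prec_less_iff by (intro inj_onI) (metis nat_neq_iff)

text \<open>Let \<open>i\<close> be the greatest element of \<open>I\<close> up to \<open>b\<close>
  and \<open>j1\<close> the least element of \<open>J\<close> from \<open>i\<close> on. Then
  \<open>i\<close> immediately precedes \<open>j1\<close>, so \<open>i = prec I J j1\<close> is in
  both sets.\<close>

lemma prec_cut:
  assumes "finite I" "finite J" "a \<in> I" "b \<in> prec I J ` J" "a \<le> b"
  shows "\<exists>c\<in>I \<inter> prec I J ` J. a \<le> c \<and> c \<le> b"
proof -
  obtain j where j: "j \<in> J" "b = prec I J j" using assms(4) by blast
  define A where "A = {i \<in> I. i \<le> b}"
  have "finite A" "a \<in> A" using assms by (auto simp: A_def)
  define i where "i = Max A"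
  have "i \<in> A" and max: "\<And>x. x \<in> A \<Longrightarrow> x \<le> i"
    using Max_in[of A] Max_ge[of A] \<open>finite A\<close> \<open>a \<in> A\<close> unfolding i_def by blast+
  then have i: "i \<in> I" "i \<le> b" "a \<le> i" using \<open>a \<in> A\<close> by (auto simp: A_def)
  define D where "D = {j' \<in> J. i \<le> j'}"
  have "finite D" "j \<in> D" using assms(2) j i(2) prec_le[of I J j] by (auto simp: D_def)
  define j1 where "j1 = Min D"
  have "j1 \<in> D" and min: "\<And>x. x \<in> D \<Longrightarrow> j1 \<le> x"
    using Min_in[of D] Min_le[of D] \<open>finite D\<close> \<open>j \<in> D\<close> unfolding j1_def by blast+
  then have j1: "j1 \<in> J" "i \<le> j1" by (auto simp: D_def)
  have "imm_precedes I J (Plain i) (Bar j1)"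
    unfolding imm_precedes_iff
  proof (intro conjI ballI)
    fix i' assume "i' \<in> I"
    show "\<not> (i < i' \<and> i' \<le> j1)"
    proof
      assume *: "i < i' \<and> i' \<le> j1"
      then have "i' \<le> j" using min[OF \<open>j \<in> D\<close>] by simp
      then have "i' \<le> b" using le_prec_iff[OF \<open>i' \<in> I\<close>] j(2) by blast
      then show False using max[of i'] * \<open>i' \<in> I\<close> by (auto simp: A_def)
    qed
  next
    fix j' assume "j' \<in> J"
    then show "\<not> (i \<le> j' \<and> j' < j1)" using min[of j'] by (auto simp: D_def)
  qed (use i j1 in auto)
  then have "i = prec I J j1" by (rule prec_eq[symmetric])
  then show ?thesis using i j1(1) by blast
qed

section \<open>The graph G as a caterpillar\<close>

lemma caterpillar_prec:
  assumes "finite I" "finite J" shows "caterpillar I (prec I J ` J)"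
  using assms prec_cut by unfold_locales auto

lemma prec_graph_eq: "prec_graph I J = {(a, b). a \<in> I \<and> b \<in> prec I J ` J \<and> a < b}"
  by (auto simp: prec_graph_def)

text \<open>On a path with at least two edges the second vertex is the head of one edge and the tail
  of another, so it lies in \<open>I \<inter> K\<close> strictly between the ends. Conversely such a
  \<open>c\<close> gives the path \<open>[a, c, b]\<close>.\<close>

lemma G_graph_eq:
  assumes "finite I" "finite J"
  shows "G_graph I J = caterpillar.G I (prec I J ` J)"
proof -
  let ?K = "prec I J ` J" and ?H = "prec_graph I J"
  have H: "(\<exists>P. dipath ?H a P b \<and> length (path_edges P) \<ge> 2) \<longleftrightarrow> (\<exists>c\<in>I \<inter> ?K. a < c \<and> c < b)"
    if ab: "(a, b) \<in> ?H" for a b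
  proof
    assume "\<exists>P. dipath ?H a P b \<and> length (path_edges P) \<ge> 2"
    then obtain P where P: "dipath ?H a P b" "length (path_edges P) \<ge> 2" by blast
    then have "length P \<ge> 3" by (simp add: path_edges_def)
    then obtain x c y P' where P': "P = x # c # y # P'"
      by (auto simp: numeral_3_eq_3 Suc_le_length_iff)
    have "successively (<) P"
      using P(1) unfolding dipath_def by (auto elim!: successively_mono simp: prec_graph_eq)
    then have "sorted_wrt (<) P" by (simp add: successively_conv_sorted_wrt)
    moreover have "b \<in> set (y # P')" "x = a" "(a, c) \<in> ?H" "(c, y) \<in> ?H"
      using P(1) P' by (auto simp: dipath_def)
    ultimately show "\<exists>c\<in>I \<inter> ?K. a < c \<and> c < b"
      using P' by (intro bexI[of _ c]) (auto simp: prec_graph_eq)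
  next
    assume "\<exists>c\<in>I \<inter> ?K. a < c \<and> c < b"
    then obtain c where "c \<in> I" "c \<in> ?K" "a < c" "c < b" by blast
    then have "dipath ?H a [a, c, b] b"
      using ab by (auto simp: dipath_def prec_graph_eq)
    then show "\<exists>P. dipath ?H a P b \<and> length (path_edges P) \<ge> 2"
      by (intro exI[of _ "[a, c, b]"]) (simp add: path_edges_def)
  qed
  have "(a, b) \<in> G_graph I J \<longleftrightarrow> (a, b) \<in> caterpillar.G I ?K" for a b
  proof -
    have "(a, b) \<in> G_graph I J \<longleftrightarrow> (a, b) \<in> ?H \<and> \<not> (\<exists>c\<in>I \<inter> ?K. a < c \<and> c < b)"
      unfolding G_graph_def min_graph_def mem_Collect_eq split using H by blast
    then show ?thesis
      unfolding caterpillar.G_def[OF caterpillar_prec[OF assms]] prec_graph_eq by blast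
  qed
  then show ?thesis by auto
qed

locale finite_pair =
  fixes I J :: "nat set"
  assumes finite_I: "finite I" and finite_J: "finite J"
begin

abbreviation K :: "nat set" where "K \<equiv> prec I J ` J"

sublocale caterpillar I K
  using caterpillar_prec[OF finite_I finite_J] .

text \<open>Inserting \<open>0\<close> makes the set whose maximum is taken non-empty.\<close>

sublocale reduction "{(a, b). a \<in> I \<and> b \<in> K \<and> a < b}" "Max (insert 0 K)"
  using fin by unfold_locales (auto simp: trans_def)

lemma G_eq: "G_graph I J = G"
  by (rule G_graph_eq[OF finite_I finite_J])

abbreviation arrows :: "(nat \<times> nat) set" where "arrows \<equiv> arc_pairs I K"

lemma finite_arrows: "finite arrows"
  by (rule finite_arc_pairs[OF fin])

lemma good_G: "good (graph_monomial G)"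
  by (rule good_graph_monomial[OF finite_G _ planar_G]) (auto dest: G_D)

lemma exists_length_reduced_form: "\<exists>p. length_reduced_form (G_graph I J) p"
  using exists_reduced[OF good_G] unfolding length_reduced_form_def G_eq .

text \<open>The vertices of the simplex of \<open>M\<close>, as pairs of end points of routes; the
  loops account for the routes common to all these simplices.\<close>

definition facet :: "monomial \<Rightarrow> (nat \<times> nat) set" where
  "facet M = edges M \<union> loops (I \<inter> K)"

context
  fixes p assumes p: "length_reduced_form (G_graph I J) p"
begin

lemma steps: "length_step\<^sup>*\<^sup>* (graph_monomial G) p" and reduced: "is_reduced p"
  using p unfolding length_reduced_form_def G_eq by blast+

lemma reduced_edges:
  assumes "M \<in> Poly_Mapping.keys p"
  shows "edges M \<subseteq> {(a, b). a \<in> I \<and> b \<in> K \<and> a < b}" "planar (edges M)"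
    "\<And>i j k. (i, j) \<in> edges M \<Longrightarrow> (j, k) \<notin> edges M"
proof -
  have "good p" using good_covers_steps[OF steps good_G] by blast
  from good_edges[OF this assms]
  show E: "edges M \<subseteq> {(a, b). a \<in> I \<and> b \<in> K \<and> a < b}" "planar (edges M)" by blast+
  fix i j k assume ij: "(i, j) \<in> edges M"
  show "(j, k) \<notin> edges M"
  proof
    assume jk: "(j, k) \<in> edges M"
    have "is_pair M i j k"
      using ij jk subsetD[OF E(1) ij] subsetD[OF E(1) jk] unfolding is_pair_def mem_edges_iff by blast
    then show False using reduced assms unfolding is_reduced_def by blast
  qed
qed

lemma facet:
  assumes "M \<in> Poly_Mapping.keys p"
  shows "facet M \<subseteq> arrows" "noncrossing (facet M)"
proof -
  note M = reduced_edges[OF assms]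
  show "facet M \<subseteq> arrows"
    using M(1) unfolding facet_def by (auto simp: arc_pairs_def loops_def)
  show "noncrossing (facet M)"
    unfolding facet_def by (rule noncrossing_Un_loops[OF M(2) _ M(3)]) (use M(1) in auto)
qed

text \<open>Give each arc of \<open>F\<close> weight one. \<open>G\<close> carries the resulting
  flow, the reductions hand it on to a monomial of \<open>p\<close> without \<open>Beta\<close>, and
  \<open>support_subset_if_carries\<close> places \<open>F\<close> in the facet of that
  monomial.\<close>

lemma noncrossing_subset_facet:
  assumes F: "F \<subseteq> arrows" "noncrossing F"
  shows "\<exists>M\<in>Poly_Mapping.keys p. \<not> var_dvd Beta M \<and> F \<subseteq> facet M"
proof -
  define w :: "nat \<times> nat \<Rightarrow> real" where "w e = of_bool (e \<in> F)" for e
  define d where "d v = (\<Sum>e\<in>arrows. w e * bd e v)" for v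
  have "carries G (\<lambda>v. w e * bd e v)" if "e \<in> arrows" for e
  proof -
    have "carries G (bd e)"
      using path_exists[of "fst e" "snd e"] that by (auto simp: arc_pairs_def)
    then show ?thesis by (rule carries_scale) (simp add: w_def)
  qed
  then have "carries G d" unfolding d_def by (rule carries_sum[OF finite_arrows])
  then have "covers (graph_monomial G) d" by (rule covers_graph_monomial[OF finite_G])
  then have "covers p d" using good_covers_steps[OF steps good_G] by blast
  then obtain M where M: "M \<in> Poly_Mapping.keys p" "\<not> var_dvd Beta M" "carries (edges M) d"
    unfolding covers_def by blast
  have Fw: "{e \<in> arrows. w e \<noteq> 0} = F" using F(1) by (auto simp: w_def)
  have "{e \<in> arrows. w e \<noteq> 0} \<subseteq> edges M \<union> loops (I \<inter> K)"
  proof (rule support_subset_if_carries[OF fin reduced_edges[OF M(1)]])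
    show "carries (edges M) (\<lambda>v. \<Sum>e\<in>arrows. w e * bd e v)" using M(3) unfolding d_def .
    show "noncrossing {e \<in> arrows. w e \<noteq> 0}" unfolding Fw by (rule F(2))
  qed (simp_all add: w_def)
  then show ?thesis using M(1,2) unfolding Fw facet_def by blast
qed

end

section \<open>Routes and their end points\<close>

lemma factor_route_eq: "factor_route I J a b = Source # map V (path a b) @ [Sink]"
  by (simp add: factor_route_def path_def G_eq)

lemma factor_route_refl: "factor_route I J v v = [Source, V v, Sink]"
proof -
  have "dipath G v [v] v" by (simp add: dipath_def)
  from path_eq[OF this] show ?thesis by (simp add: factor_route_eq)
qed

lemma hat_edges_iff:
  "(Source, x) \<in> hat_edges I J \<longleftrightarrow> (\<exists>i\<in>I. x = V i)"
  "(x, Sink) \<in> hat_edges I J \<longleftrightarrow> (\<exists>b\<in>K. x = V b)"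
  "(V a, V b) \<in> hat_edges I J \<longleftrightarrow> (a, b) \<in> G"
  by (auto simp: hat_edges_def G_eq)

lemma hat_edges_cases:
  assumes "e \<in> hat_edges I J"
  obtains i where "i \<in> I" "e = (Source, V i)" | b where "b \<in> K" "e = (V b, Sink)"
    | u w where "(u, w) \<in> G" "e = (V u, V w)"
  using assms unfolding hat_edges_def G_eq by blast

lemma successively_route:
  assumes "P \<noteq> []"
  shows "successively (\<lambda>a b. (a, b) \<in> hat_edges I J) (Source # map V P @ [Sink]) \<longleftrightarrow>
    hd P \<in> I \<and> last P \<in> K \<and> successively (\<lambda>a b. (a, b) \<in> G) P"
  using assms
  by (auto simp: successively_Cons successively_append_iff successively_map hat_edges_iff
      hd_map last_map)

lemma path_nonempty:
  assumes "(a, b) \<in> arrows"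
  shows "path a b \<noteq> []" "hd (path a b) = a" "last (path a b) = b"
  using path[OF assms] unfolding dipath_def by blast+

lemma routes_eq: "routes I J = (\<lambda>(a, b). factor_route I J a b) ` arrows"
proof (intro equalityI subsetI)
  fix R assume "R \<in> routes I J"
  then have R: "R \<noteq> []" "hd R = Source" "last R = Sink" "distinct R"
    "successively (\<lambda>a b. (a, b) \<in> hat_edges I J) R"
    unfolding routes_def dipath_def by blast+
  obtain R' where R': "R = Source # R'" using R(1,2) by (cases R) auto
  then have "R' \<noteq> []" "last R' = Sink" using R(3) by (auto split: if_splits)
  then obtain S where S: "R' = S @ [Sink]" by (metis append_butlast_last_id)
  have "S \<noteq> []" using R(5) unfolding R' S by (auto simp: hat_edges_iff)
  \<comment> \<open>The vertices of \<open>R\<close> are distinct, so its ends \<open>Source\<close>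
    and \<open>Sink\<close> do not recur inside.\<close>
  have "\<exists>a. x = V a" if "x \<in> set S" for x
    using R(4) that unfolding R' S by (cases x) auto
  then obtain P where P: "S = map V P" using ex_map_conv[of S V] by blast
  have "P \<noteq> []" using \<open>S \<noteq> []\<close> P by simp
  have RP: "R = Source # map V P @ [Sink]" unfolding R' S P ..
  have dP: "distinct P" using R(4) unfolding RP by (simp add: distinct_map)
  have 1: "hd P \<in> I" "last P \<in> K" "successively (\<lambda>a b. (a, b) \<in> G) P"
    using R(5) unfolding RP successively_route[OF \<open>P \<noteq> []\<close>] by blast+
  have path_P: "dipath G (hd P) P (last P)"
    using 1(3) dP \<open>P \<noteq> []\<close> by (simp add: dipath_def)
  have "(hd P, last P) \<in> arrows"
    using path_structure[OF path_P] 1 by (simp add: arc_pairs_def)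
  moreover have "R = factor_route I J (hd P) (last P)"
    unfolding factor_route_eq path_eq[OF path_P] by (rule RP)
  ultimately show "R \<in> (\<lambda>(a, b). factor_route I J a b) ` arrows" by force
next
  fix R assume "R \<in> (\<lambda>(a, b). factor_route I J a b) ` arrows"
  then obtain a b where ab: "(a, b) \<in> arrows" "R = factor_route I J a b" by auto
  note ne = path_nonempty[OF ab(1)]
  have d: "distinct (path a b)" "successively (\<lambda>a b. (a, b) \<in> G) (path a b)"
    using path[OF ab(1)] unfolding dipath_def by blast+
  have "successively (\<lambda>a b. (a, b) \<in> hat_edges I J) R"
    unfolding ab(2) factor_route_eq successively_route[OF ne(1)]
    using d(2) ne ab(1) by (simp add: arc_pairs_def)
  moreover have "distinct R" unfolding ab(2) factor_route_eq
    using d(1) by (auto simp: distinct_map inj_on_def)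
  ultimately show "R \<in> routes I J"
    unfolding routes_def dipath_def by (simp add: ab(2) factor_route_eq)
qed

lemma mem_route_edges:
  assumes "(a, b) \<in> arrows"
  shows "(Source, V i) \<in> set (path_edges (factor_route I J a b)) \<longleftrightarrow> i = a"
    "(V k, Sink) \<in> set (path_edges (factor_route I J a b)) \<longleftrightarrow> k = b"
    "(V u, V w) \<in> set (path_edges (factor_route I J a b)) \<longleftrightarrow> (u, w) \<in> set (path_edges (path a b))"
  unfolding factor_route_eq path_edges_route[OF path_nonempty(1)[OF assms]] path_nonempty(2,3)[OF assms]
  by auto

lemma ends_route:
  assumes "(a, b) \<in> arrows"
  shows "hd (path_edges (factor_route I J a b)) = (Source, V a)"
    "last (path_edges (factor_route I J a b)) = (V b, Sink)"
  unfolding factor_route_eq path_edges_route[OF path_nonempty(1)[OF assms]] path_nonempty(2,3)[OF assms]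
  by simp_all

text \<open>Translates end points of routes into arcs between nodes; \<open>prec\<close> is
  injective on \<open>J\<close>, so the barred index is recovered from its image.\<close>

definition arc :: "nat \<times> nat \<Rightarrow> node \<times> node" where
  "arc e = (Plain (fst e), Bar (inv_into J (prec I J) (snd e)))"

lemma arc_prec: "j \<in> J \<Longrightarrow> arc (i, prec I J j) = (Plain i, Bar j)"
  by (simp add: arc_def inv_into_f_f[OF inj_on_prec])

lemma arrowsE:
  assumes "e \<in> arrows" obtains i j where "i \<in> I" "j \<in> J" "i \<le> j" "e = (i, prec I J j)"
  using assms le_prec_iff unfolding arc_pairs_def by auto

lemma arc_image: "arc ` arrows = arcs I J"
proof (intro equalityI subsetI)
  fix x assume "x \<in> arc ` arrows"
  then obtain e where e: "e \<in> arrows" "x = arc e" by blast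
  from e(1) obtain i j where "i \<in> I" "j \<in> J" "i \<le> j" "e = (i, prec I J j)" by (rule arrowsE)
  then show "x \<in> arcs I J" using arc_prec e(2) by (simp add: arcs_def)
next
  fix x assume "x \<in> arcs I J"
  then obtain i j where ij: "i \<in> I" "j \<in> J" "i \<le> j" "x = (Plain i, Bar j)"
    by (auto simp: arcs_def)
  then have "(i, prec I J j) \<in> arrows" using le_prec_iff by (simp add: arc_pairs_def)
  then show "x \<in> arc ` arrows" using arc_prec[OF ij(2)] ij(4) by (metis image_eqI)
qed

lemma inj_on_arc: "inj_on arc arrows"
proof (rule inj_onI)
  fix e e' assume e: "e \<in> arrows" "e' \<in> arrows" "arc e = arc e'"
  obtain i j where 1: "i \<in> I" "j \<in> J" "i \<le> j" "e = (i, prec I J j)" using e(1) by (rule arrowsE)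
  obtain i' j' where 2: "i' \<in> I" "j' \<in> J" "i' \<le> j'" "e' = (i', prec I J j')" using e(2) by (rule arrowsE)
  show "e = e'" using e(3) unfolding 1(4) 2(4) arc_prec[OF 1(2)] arc_prec[OF 2(2)] by simp
qed

text \<open>By \<open>le_prec_iff\<close>, \<open>a' \<le> b\<close> says that the plain node
  \<open>a'\<close> precedes the barred end of the first arc; the barred ends are compared by
  monotonicity of \<open>prec\<close>.\<close>

lemma crossing_arc:
  assumes "(a, b) \<in> arrows" "(a', b') \<in> arrows"
  shows "crossing (arc (a, b)) (arc (a', b')) \<longleftrightarrow> a < a' \<and> a' \<le> b \<and> b < b'"
proof -
  obtain j where j: "j \<in> J" "b = prec I J j" using assms(1) by (auto simp: arc_pairs_def)
  obtain j' where j': "j' \<in> J" "b' = prec I J j'" using assms(2) by (auto simp: arc_pairs_def)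
  have "a' \<in> I" using assms(2) by (simp add: arc_pairs_def)
  then show ?thesis
    unfolding j(2) j'(2) arc_prec[OF j(1)] arc_prec[OF j'(1)] crossing_def
    by (simp add: le_prec_iff prec_less_iff[OF j(1) j'(1)])
qed

lemma is_forest_arc:
  assumes "F \<subseteq> arrows" shows "is_forest I J (arc ` F) \<longleftrightarrow> noncrossing F"
proof -
  have "arc ` F \<subseteq> arcs I J" using image_mono[OF assms, of arc] unfolding arc_image .
  moreover have "(\<exists>e\<in>arc ` F. \<exists>f\<in>arc ` F. crossing e f) \<longleftrightarrow>
      (\<exists>a b. (a, b) \<in> F \<and> (\<exists>a' b'. (a', b') \<in> F \<and> crossing (arc (a, b)) (arc (a', b'))))"
    by (simp add: Bex_def split_paired_Ex)
  moreover have "crossing (arc (a, b)) (arc (a', b')) \<longleftrightarrow> a < a' \<and> a' \<le> b \<and> b < b'"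
    if "(a, b) \<in> F" "(a', b') \<in> F" for a b a' b'
    using crossing_arc that assms by blast
  moreover have "noncrossing F \<longleftrightarrow>
      \<not> (\<exists>a b. (a, b) \<in> F \<and> (\<exists>a' b'. (a', b') \<in> F \<and> a < a' \<and> a' \<le> b \<and> b < b'))"
    unfolding noncrossing_def not_less[symmetric] by blast
  ultimately show ?thesis
    unfolding is_forest_def by (simp cong: conj_cong)
qed

lemma tamari_complex_eq: "tamari_complex I J = {arc ` F | F. F \<subseteq> arrows \<and> noncrossing F}"
proof (intro equalityI subsetI)
  fix A assume "A \<in> tamari_complex I J"
  then have A: "is_forest I J A" unfolding tamari_complex_def by blast
  then have "A \<subseteq> arc ` arrows" unfolding arc_image is_forest_def by blast
  then obtain F where F: "F \<subseteq> arrows" "A = arc ` F" by (rule subset_imageE)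
  then show "A \<in> {arc ` F | F. F \<subseteq> arrows \<and> noncrossing F}"
    using A is_forest_arc[OF F(1)] by blast
next
  fix A assume "A \<in> {arc ` F | F. F \<subseteq> arrows \<and> noncrossing F}"
  then show "A \<in> tamari_complex I J"
    using is_forest_arc unfolding tamari_complex_def by blast
qed

end

subsection \<open>Route vectors\<close>

text \<open>The hull lies in the unit cube. If a proper convex combination of two points of the cube
  has a coordinate 0 or 1, both points share that coordinate; so no point of \<open>S\<close> is
  interior to a segment.\<close>

lemma extreme_points_zero_one:
  fixes S :: "(real^'e) set"
  assumes S: "\<And>x i. x \<in> S \<Longrightarrow> x $ i = 0 \<or> x $ i = 1"
  shows "vertices_of (convex hull S) = S"
proof -
  have cube: "convex hull S \<subseteq> cbox 0 1"
  proof (rule hull_minimal)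
    show "S \<subseteq> cbox 0 1"
    proof
      fix x assume x: "x \<in> S"
      have "0 \<le> x $ i \<and> x $ i \<le> 1" for i using S[OF x, of i] by auto
      then show "x \<in> cbox 0 1" by (simp add: mem_box_cart)
    qed
  qed (rule convex_box)
  have "x extreme_point_of convex hull S" if x: "x \<in> S" for x
    unfolding extreme_point_of_def
  proof (intro conjI ballI notI)
    show "x \<in> convex hull S" using x by (rule hull_inc)
    fix a b assume ab: "a \<in> convex hull S" "b \<in> convex hull S" and "x \<in> open_segment a b"
    then obtain u where u: "a \<noteq> b" "0 < u" "u < 1" "x = (1 - u) *\<^sub>R a + u *\<^sub>R b"
      unfolding in_segment by blast
    have "a $ i = b $ i" for i
    proof -
      have bnd: "0 \<le> a $ i" "a $ i \<le> 1" "0 \<le> b $ i" "b $ i \<le> 1"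
        using ab cube unfolding subset_iff mem_box_cart by auto
      have xi: "x $ i = (1 - u) * a $ i + u * b $ i" using u(4) by simp
      consider "x $ i = 0" | "x $ i = 1" using S[OF x] by blast
      then show ?thesis
      proof cases
        case 1
        have "(1 - u) * a $ i \<ge> 0" "u * b $ i \<ge> 0" using bnd u by simp_all
        then have "(1 - u) * a $ i = 0" "u * b $ i = 0" using 1 xi by linarith+
        then show ?thesis using u by simp
      next
        case 2
        have "(1 - u) * (1 - a $ i) \<ge> 0" "u * (1 - b $ i) \<ge> 0" using bnd u by simp_all
        moreover have "(1 - u) * (1 - a $ i) + u * (1 - b $ i) = 0"
          using 2 xi by (simp add: algebra_simps)
        ultimately have "(1 - u) * (1 - a $ i) = 0" "u * (1 - b $ i) = 0" by linarith+
        then show ?thesis using u by simp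
      qed
    qed
    then show False using u(1) by (simp add: vec_eq_iff)
  qed
  then show ?thesis
    unfolding vertices_of_def using extreme_point_of_convex_hull by blast
qed

locale flow_realization = finite_pair I J for I J :: "nat set" +
  fixes \<epsilon> :: "'e::finite \<Rightarrow> vertex \<times> vertex"
  assumes bij_\<epsilon>: "bij_betw \<epsilon> UNIV (hat_edges I J)"
begin

definition rvec :: "nat \<times> nat \<Rightarrow> real^'e" where
  "rvec e = route_vec \<epsilon> (factor_route I J (fst e) (snd e))"

lemma rvec_nth: "rvec (a, b) $ x = (if \<epsilon> x \<in> set (path_edges (factor_route I J a b)) then 1 else 0)"
  by (simp add: rvec_def route_vec_def)

lemma \<epsilon>_surj: "e \<in> hat_edges I J \<Longrightarrow> \<exists>x. \<epsilon> x = e"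
  using bij_\<epsilon> unfolding bij_betw_def by (metis imageE)

lemma \<epsilon>_mem: "\<epsilon> x \<in> hat_edges I J"
  using bij_\<epsilon> unfolding bij_betw_def by blast

text \<open>At an edge from \<open>Source\<close> or into \<open>Sink\<close> the coordinate depends
  on one end point only. At an edge of \<open>G\<close> it is a product of a factor in each end
  point, one of which is unaffected by the exchange.\<close>

lemma uncross_rvec:
  assumes ab: "(a, b) \<in> arrows" "(a', b') \<in> arrows" "a < a'" "a' \<le> b" "b < b'"
  shows "(a', b) \<in> arrows" "(a, b') \<in> arrows"
    "rvec (a, b) + rvec (a', b') = rvec (a', b) + rvec (a, b')"
proof -
  show new: "(a', b) \<in> arrows" "(a, b') \<in> arrows" using ab by (auto simp: arc_pairs_def)
  have "rvec (a, b) $ x + rvec (a', b') $ x = rvec (a', b) $ x + rvec (a, b') $ x" for x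
    using \<epsilon>_mem[of x]
  proof (cases rule: hat_edges_cases)
    case (1 i)
    show ?thesis unfolding rvec_nth 1(2)
      by (simp add: mem_route_edges[OF ab(1)] mem_route_edges[OF ab(2)]
          mem_route_edges[OF new(1)] mem_route_edges[OF new(2)])
  next
    case (2 k)
    show ?thesis unfolding rvec_nth 2(2)
      by (simp add: mem_route_edges[OF ab(1)] mem_route_edges[OF ab(2)]
          mem_route_edges[OF new(1)] mem_route_edges[OF new(2)])
  next
    case (3 u w)
    define \<alpha> where "\<alpha> x \<longleftrightarrow> u = x \<or> u \<in> I \<inter> K \<and> x < u" for x
    define \<beta> where "\<beta> y \<longleftrightarrow> w = y \<or> w \<in> I \<inter> K \<and> w < y" for y
    have coord: "rvec (x1, y1) $ x = (if \<alpha> x1 \<and> \<beta> y1 then 1 else 0)" if "(x1, y1) \<in> arrows" for x1 y1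
      unfolding rvec_nth 3(2) mem_route_edges(3)[OF that] mem_path_edges[OF that 3(1)] \<alpha>_def \<beta>_def ..
    have "\<alpha> a = \<alpha> a' \<or> \<beta> b = \<beta> b'"
      using uncross_coordinate[OF ab 3(1)] unfolding \<alpha>_def \<beta>_def .
    then show ?thesis
      unfolding coord[OF ab(1)] coord[OF ab(2)] coord[OF new(1)] coord[OF new(2)] by auto
  qed
  then show "rvec (a, b) + rvec (a', b') = rvec (a', b) + rvec (a, b')"
    by (simp add: vec_eq_iff)
qed

lemma linear_nth: "linear (\<lambda>v :: real^'e. v $ x)"
  by (rule linearI) simp_all

text \<open>The functionals are the coordinates at \<open>(Source, V a)\<close> and
  \<open>(V b, Sink)\<close>, or zero when no arc has the end in question.\<close>

sublocale noncrossing_configuration arrows rvec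
proof
  show "finite arrows" by (rule finite_arrows)
  show "a \<le> b" if "(a, b) \<in> arrows" for a b using that by (simp add: arc_pairs_def)
  show "(a', b) \<in> arrows \<and> (a, b') \<in> arrows \<and> rvec (a, b) + rvec (a', b') = rvec (a', b) + rvec (a, b')"
    if "(a, b) \<in> arrows" "(a', b') \<in> arrows" "a < a'" "a' \<le> b" "b < b'" for a b a' b'
    using uncross_rvec[OF that] by blast
  show "\<exists>l. linear l \<and> (\<forall>e\<in>arrows. l (rvec e) = (if fst e = a then 1 else 0 :: real))" for a
  proof (cases "a \<in> I")
    case True
    then obtain x where x: "\<epsilon> x = (Source, V a)" using \<epsilon>_surj hat_edges_iff(1) by blast
    have "\<forall>e\<in>arrows. rvec e $ x = (if fst e = a then 1 else 0)"
      by (auto simp: rvec_nth x mem_route_edges)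
    then show ?thesis by (intro exI[of _ "\<lambda>v. v $ x"] conjI linear_nth)
  next
    case False
    then have "\<forall>e\<in>arrows. (0::real) = (if fst e = a then 1 else 0)" by (auto simp: arc_pairs_def)
    then show ?thesis by (intro exI[of _ "\<lambda>_. 0"] conjI linear_zero)
  qed
  show "\<exists>l. linear l \<and> (\<forall>e\<in>arrows. l (rvec e) = (if snd e = b then 1 else 0 :: real))" for b
  proof (cases "b \<in> K")
    case True
    then obtain x where x: "\<epsilon> x = (V b, Sink)" using \<epsilon>_surj hat_edges_iff(2) by blast
    have "\<forall>e\<in>arrows. rvec e $ x = (if snd e = b then 1 else 0)"
      by (auto simp: rvec_nth x mem_route_edges)
    then show ?thesis by (intro exI[of _ "\<lambda>v. v $ x"] conjI linear_nth)
  next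
    case False
    then have "\<forall>e\<in>arrows. (0::real) = (if snd e = b then 1 else 0)" by (auto simp: arc_pairs_def)
    then show ?thesis by (intro exI[of _ "\<lambda>_. 0"] conjI linear_zero)
  qed
qed

lemma flow_polytope_eq: "flow_polytope \<epsilon> I J = convex hull (rvec ` arrows)"
  unfolding flow_polytope_def routes_eq image_image rvec_def by (simp add: case_prod_unfold)

lemma vertices_flow_polytope: "vertices_of (flow_polytope \<epsilon> I J) = rvec ` arrows"
  unfolding flow_polytope_eq
  by (rule extreme_points_zero_one) (auto simp: rvec_nth)

lemma Delta_eq: "Delta \<epsilon> I J M = convex hull (rvec ` facet M)"
proof -
  have "{route_vec \<epsilon> (factor_route I J a b) | a b. var_dvd (X a b) M} = rvec ` edges M"
    unfolding rvec_def edges_def by (auto simp: image_def)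
  moreover have "{route_vec \<epsilon> [Source, V v, Sink] | v. v \<in> I \<inter> prec I J ` J} = rvec ` loops (I \<inter> K)"
    unfolding rvec_def loops_def by (auto simp: image_def factor_route_refl)
  ultimately show ?thesis unfolding Delta_def facet_def image_Un by simp
qed

text \<open>Faces of \<open>Delta\<close> are hulls of subsets of a non-crossing facet; conversely
  \<open>noncrossing_subset_facet\<close> puts every non-crossing set into some facet.\<close>

lemma T_len_eq:
  assumes p: "length_reduced_form (G_graph I J) p"
  shows "T_len \<epsilon> I J p = noncrossing_complex"
proof (intro equalityI subsetI)
  fix S assume "S \<in> T_len \<epsilon> I J p"
  then obtain M where M: "M \<in> Poly_Mapping.keys p" "S face_of convex hull (rvec ` facet M)"
    unfolding T_len_def Delta_eq by blast
  note fM = facet[OF p M(1)]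
  obtain F where "F \<subseteq> facet M" "S = convex hull (rvec ` F)"
    using M(2) unfolding face_of_hull_iff[OF fM] by blast
  then show "S \<in> noncrossing_complex"
    using fM noncrossing_subset[OF fM(2)] unfolding noncrossing_complex_def by blast
next
  fix S assume "S \<in> noncrossing_complex"
  then obtain F where F: "F \<subseteq> arrows" "noncrossing F" "S = convex hull (rvec ` F)"
    unfolding noncrossing_complex_def by blast
  obtain M where M: "M \<in> Poly_Mapping.keys p" "\<not> var_dvd Beta M" "F \<subseteq> facet M"
    using noncrossing_subset_facet[OF p F(1,2)] by blast
  have "S face_of convex hull (rvec ` facet M)"
    unfolding face_of_hull_iff[OF facet[OF p M(1)]] using M(3) F(3) by blast
  then show "S \<in> T_len \<epsilon> I J p" using M(1,2) unfolding T_len_def Delta_eq by blast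
qed

text \<open>Meaningful on the vertices of the polytope, where \<open>rvec\<close> can be
  inverted.\<close>

definition to_arc :: "real^'e \<Rightarrow> node \<times> node" where
  "to_arc x = arc (the_inv_into arrows rvec x)"

lemma to_arc_rvec: "e \<in> arrows \<Longrightarrow> to_arc (rvec e) = arc e"
  unfolding to_arc_def by (simp add: the_inv_into_f_f[OF inj_on_vec])

lemma to_arc_route:
  assumes "R \<in> routes I J" "j \<in> J"
    and "hd (path_edges R) = (Source, V i)" "last (path_edges R) = (V (prec I J j), Sink)"
  shows "to_arc (route_vec \<epsilon> R) = (Plain i, Bar j)"
proof -
  obtain a b where ab: "(a, b) \<in> arrows" "R = factor_route I J a b"
    using assms(1) unfolding routes_eq by auto
  have "a = i" "b = prec I J j"
    using assms(3,4) ends_route[OF ab(1)] unfolding ab(2) by simp_all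
  moreover have "route_vec \<epsilon> R = rvec (a, b)" by (simp add: ab(2) rvec_def)
  ultimately show ?thesis using to_arc_rvec[OF ab(1)] arc_prec[OF assms(2)] by simp
qed

lemma bij_betw_to_arc: "bij_betw to_arc (vertices_of (flow_polytope \<epsilon> I J)) (arcs I J)"
proof (rule bij_betw_imageI)
  show "inj_on to_arc (vertices_of (flow_polytope \<epsilon> I J))"
    unfolding vertices_flow_polytope
    using inj_on_arc by (auto simp: inj_on_def to_arc_rvec)
  show "to_arc ` vertices_of (flow_polytope \<epsilon> I J) = arcs I J"
    unfolding vertices_flow_polytope arc_image[symmetric] image_image
    by (rule image_cong) (simp_all add: to_arc_rvec)
qed

lemma to_arc_faces: "(\<lambda>S. to_arc ` vertices_of S) ` noncrossing_complex = tamari_complex I J"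
proof -
  have *: "to_arc ` vertices_of (convex hull (rvec ` F)) = arc ` F"
    if F: "F \<subseteq> arrows" "noncrossing F" for F
    unfolding extreme_points_hull[OF F] image_image
    by (rule image_cong) (use F(1) to_arc_rvec in auto)
  have nc: "noncrossing_complex = (\<lambda>F. convex hull (rvec ` F)) ` {F. F \<subseteq> arrows \<and> noncrossing F}"
    unfolding noncrossing_complex_def by blast
  have "(\<lambda>S. to_arc ` vertices_of S) ` noncrossing_complex =
      (\<lambda>F. arc ` F) ` {F. F \<subseteq> arrows \<and> noncrossing F}"
    unfolding nc image_image[of "\<lambda>S. to_arc ` vertices_of S"]
    by (rule image_cong[OF refl], rule *) blast+
  also have "\<dots> = tamari_complex I J" unfolding tamari_complex_eq by blast
  finally show ?thesis .
qed

end

theorem theorem4p6: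
  fixes n :: nat and I J :: "nat set" and \<epsilon> :: "'e::finite \<Rightarrow> vertex \<times> vertex"
  assumes "n \<ge> 1"
    and "valid_pair n I J"
    and "bij_betw \<epsilon> UNIV (hat_edges I J)"
  shows "(\<exists>p. length_reduced_form (G_graph I J) p) \<and>
    (\<exists>\<phi>.
      (\<forall>R \<in> routes I J. \<forall>i \<in> I. \<forall>j \<in> J.
         hd (path_edges R) = (Source, V i) \<and> last (path_edges R) = (V (prec I J j), Sink) \<longrightarrow>
         \<phi> (route_vec \<epsilon> R) = (Plain i, Bar j)) \<and>
      bij_betw \<phi> (vertices_of (flow_polytope \<epsilon> I J)) (arcs I J) \<and>
      (\<forall>p. length_reduced_form (G_graph I J) p \<longrightarrow>
         simplicial_complex (T_len \<epsilon> I J p) \<and>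
         \<Union> (T_len \<epsilon> I J p) = flow_polytope \<epsilon> I J \<and>
         (\<lambda>S. \<phi> ` vertices_of S) ` T_len \<epsilon> I J p = tamari_complex I J))"
proof -
  have "finite I" "finite J"
    using assms(2) unfolding valid_pair_def by (auto intro: finite_subset)
  then interpret flow_realization I J \<epsilon>
    using assms(3) by unfold_locales
  \<comment> \<open>One map serves for all \<open>p\<close>, since \<open>T_len_eq\<close>
    identifies every \<open>T_len \<epsilon> I J p\<close> with the same complex.\<close>
  have T: "simplicial_complex (T_len \<epsilon> I J p) \<and> \<Union> (T_len \<epsilon> I J p) = flow_polytope \<epsilon> I J \<and>
      (\<lambda>S. to_arc ` vertices_of S) ` T_len \<epsilon> I J p = tamari_complex I J"
    if "length_reduced_form (G_graph I J) p" for p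
    unfolding T_len_eq[OF that] flow_polytope_eq
    by (intro conjI simplicial_complex_complex Union_complex to_arc_faces)
  have R: "\<forall>R\<in>routes I J. \<forall>i\<in>I. \<forall>j\<in>J.
      hd (path_edges R) = (Source, V i) \<and> last (path_edges R) = (V (prec I J j), Sink) \<longrightarrow>
      to_arc (route_vec \<epsilon> R) = (Plain i, Bar j)"
    using to_arc_route by blast
  show ?thesis
    using exists_length_reduced_form R bij_betw_to_arc T by blast
qed

end
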